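(* Let $M$ and $N$ be compact metric spaces such that $N$ is a Lipschitz quotient of $M$. Then $\alpha_{cf}(N)\leq\alpha_{cf}(M)$.
   Context: Lipschitz quotients: $B_M(x,r)$ denotes the closed ball. The co-Lipschitz constant $\text{co-Lip}(f)$ of $f\colon M\to N$ is the infimum of all $C>0$ such that $B_N(f(x),r)\subset f(B_M(x,Cr))$ for all $x\in M$, $r>0$; $f$ is co-Lipschitz if $\text{co-Lip}(f)<\infty$. A Lipschitz quotient map is a map that is Lipschitz and co-Lipschitz; $N$ is a Lipschitz quotient of $M$ if such a map $M\to N$ exists. Curve-flat quotients: a curve-fragment in $M$ is a Lipschitz map $\varphi\colon K\to M$ with $K\subset\mathbb{R}$ compact. For a metric space $(M,d)$ the curve-flat pseudometric is $d_{cf}(x,y)=\inf \lambda([\min K,\max K]\setminus K)$, the infimum being over all $1$-Lipschitz curve-fragments $\varphi\colon K\to M$ with $\varphi(\min K)=x$, $\varphi(\max K)=y$, where $\lambda$ is Lebesgue measure. Identifying points at $d_{cf}$-distance $0$ gives the metric space $(M_{cf},d_{cf})$, the curve-flat quotient of $M$. By transfinite induction: $M^0_{cf}=M$, $d^0_{cf}=d$; $d_{cf}^{\alpha+1}=(d_{cf}^\alpha)_{cf}$ and $M_{cf}^{\alpha+1}=(M_{cf}^\alpha)_{cf}$; for limit $\alpha$, $d_{cf}^\alpha(x,y)=\inf_{\beta<\alpha}d_{cf}^\beta(x,y)$ and $M_{cf}^\alpha$ is the quotient of $M$ by $d_{cf}^\alpha$ with metric $d_{cf}^\alpha$ (each $d_{cf}^\alpha$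 is regarded also as a pseudometric on $M$). A metric space is purely $1$-unrectifiable if it contains no bi-Lipschitz copy of a subset of $\mathbb{R}$ of positive Lebesgue measure. The curve-flat index $\alpha_{cf}(M)$ is the smallest ordinal $\alpha$ such that $M_{cf}^\alpha$ is purely $1$-unrectifiable (equivalently, the ordinal at which the sequence $(M_{cf}^\alpha)_\alpha$ stabilizes). *)

theory Defs
  imports "HOL-Analysis.Analysis" "HOL-Library.Infinite_Typeclass"
begin

section \<open>Ordinals\<close>

text \<open>The elements of \<open>'u ordinal\<close> are the order types of well-orders whose field is a subset of
  \<open>'u\<close>, i.e. the ordinals of cardinality at most that of \<open>'u\<close>.  If \<open>'u\<close> is infinite, they include
  all countable ordinals and there is no largest one.\<close>

quotient_type 'u ordinal = "'u rel" / partial: "\<lambda>r s. (r, s) \<in> ordIso"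
proof (rule part_equivpI)
  have "Well_order ({} :: 'u rel)"
    by simp
  then show "\<exists>r :: 'u rel. (r, r) \<in> ordIso"
    using ordIso_reflexive by blast
  show "symp (\<lambda>r s :: 'u rel. (r, s) \<in> ordIso)"
    by (auto intro: sympI ordIso_symmetric)
  show "transp (\<lambda>r s :: 'u rel. (r, s) \<in> ordIso)"
    by (auto intro: transpI ordIso_transitive)
qed

instantiation ordinal :: (type) wellorder
begin

lift_definition less_eq_ordinal :: "'a ordinal \<Rightarrow> 'a ordinal \<Rightarrow> bool"
  is "\<lambda>r s. (r, s) \<in> ordLeq"
  by (meson ordIso_ordLeq_trans ordIso_symmetric ordLeq_ordIso_trans)

lift_definition less_ordinal :: "'a ordinal \<Rightarrow> 'a ordinal \<Rightarrow> bool"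
  is "\<lambda>r s. (r, s) \<in> ordLess"
  by (meson ordIso_ordLess_trans ordIso_symmetric ordLess_ordIso_trans)

instance
proof
  fix \<alpha> \<beta> \<gamma> :: "'a ordinal"
  show "\<alpha> < \<beta> \<longleftrightarrow> \<alpha> \<le> \<beta> \<and> \<not> \<beta> \<le> \<alpha>"
    by transfer (metis not_ordLess_ordLeq not_ordLeq_iff_ordLess ordIso_iff_ordLeq ordLeq_Well_order_simp
        ordLess_imp_ordLeq ordIso_symmetric)
  show "\<alpha> \<le> \<alpha>"
    by transfer (rule ordIso_imp_ordLeq)
  show "\<alpha> \<le> \<beta> \<Longrightarrow> \<beta> \<le> \<gamma> \<Longrightarrow> \<alpha> \<le> \<gamma>"
    by transfer (rule ordLeq_transitive)
  show "\<alpha> \<le> \<beta> \<Longrightarrow> \<beta> \<le> \<alpha> \<Longrightarrow> \<alpha> = \<beta>"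
    by transfer (simp add: ordIso_iff_ordLeq)
  show "\<alpha> \<le> \<beta> \<or> \<beta> \<le> \<alpha>"
    by transfer (metis ordIso_iff_ordLeq ordLeq_Well_order_simp ordLeq_total)
next
  fix P :: "'a ordinal \<Rightarrow> bool" and \<alpha> :: "'a ordinal"
  assume step: "\<And>\<alpha>. (\<And>\<beta>. \<beta> < \<alpha> \<Longrightarrow> P \<beta>) \<Longrightarrow> P \<alpha>"
  have "Well_order r \<Longrightarrow> P (abs_ordinal r)" for r :: "'a rel"
  proof (induction r rule: wf_induct_rule[OF wf_ordLess])
    case (1 r)
    have "P \<beta>" if "\<beta> < abs_ordinal r" for \<beta>
    proof -
      have rep: "(rep_ordinal \<beta>, rep_ordinal \<beta>) \<in> ordIso"
        by (rule Quotient3_rep_reflp[OF Quotient3_ordinal])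
      have eq: "abs_ordinal (rep_ordinal \<beta>) = \<beta>"
        by (rule Quotient3_abs_rep[OF Quotient3_ordinal])
      have "(r, r) \<in> ordIso"
        using 1(2) by (rule ordIso_reflexive)
      then have "(rep_ordinal \<beta>, r) \<in> ordLess"
        using that rep eq by (metis less_ordinal.abs_eq)
      then show ?thesis
        using 1(1)[of "rep_ordinal \<beta>"] rep eq by (metis ordLess_imp_ordLeq ordLeq_Well_order_simp)
    qed
    then show ?case
      by (rule step)
  qed
  moreover have "Well_order (rep_ordinal \<alpha>)"
    using Quotient3_rep_reflp[OF Quotient3_ordinal, of \<alpha>] ordIso_iff_ordLeq ordLeq_Well_order_simp by blast
  ultimately show "P \<alpha>"
    using Quotient3_abs_rep[OF Quotient3_ordinal, of \<alpha>] by metis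
qed

end

definition is_pred :: "'o::linorder \<Rightarrow> 'o \<Rightarrow> bool" where
  "is_pred \<beta> \<alpha> \<longleftrightarrow> \<beta> < \<alpha> \<and> (\<forall>\<gamma><\<alpha>. \<gamma> \<le> \<beta>)"

lemma is_pred_unique: "is_pred \<beta> \<alpha> \<Longrightarrow> is_pred \<gamma> \<alpha> \<Longrightarrow> \<beta> = \<gamma>"
  unfolding is_pred_def by (meson antisym)

lemma is_pred_the: "is_pred \<beta> \<alpha> \<Longrightarrow> (THE \<gamma>. is_pred \<gamma> \<alpha>) = \<beta>"
  using is_pred_unique by blast


section \<open>Lipschitz quotients\<close>

definition co_Lip :: "'a metric \<Rightarrow> 'b metric \<Rightarrow> ('a \<Rightarrow> 'b) \<Rightarrow> ereal" where
  "co_Lip M N f = Inf {ereal C | C. C > 0 \<and>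
     (\<forall>x \<in> mspace M. \<forall>r>0. mcball_of N (f x) r \<subseteq> f ` mcball_of M x (C * r))}"

definition co_Lipschitz_map :: "'a metric \<Rightarrow> 'b metric \<Rightarrow> ('a \<Rightarrow> 'b) \<Rightarrow> bool" where
  "co_Lipschitz_map M N f \<longleftrightarrow> co_Lip M N f < \<infinity>"

definition Lipschitz_quotient_map :: "'a metric \<Rightarrow> 'b metric \<Rightarrow> ('a \<Rightarrow> 'b) \<Rightarrow> bool" where
  "Lipschitz_quotient_map M N f \<longleftrightarrow> Lipschitz_continuous_map M N f \<and> co_Lipschitz_map M N f"

text \<open>If \<open>M\<close> is empty, then every \<open>N\<close> is vacuously a Lipschitz quotient of \<open>M\<close>; for nonempty \<open>M\<close> a
  co-Lipschitz map is onto.\<close>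

definition Lipschitz_quotient_of :: "'b metric \<Rightarrow> 'a metric \<Rightarrow> bool" where
  "Lipschitz_quotient_of N M \<longleftrightarrow> (\<exists>f. Lipschitz_quotient_map M N f)"


section \<open>Purely 1-unrectifiable metric spaces\<close>

definition bi_Lipschitz_on :: "real set \<Rightarrow> 'a metric \<Rightarrow> (real \<Rightarrow> 'a) \<Rightarrow> bool" where
  "bi_Lipschitz_on S M f \<longleftrightarrow> f \<in> S \<rightarrow> mspace M \<and>
     (\<exists>a>0. \<exists>b. \<forall>s\<in>S. \<forall>t\<in>S. a * dist s t \<le> mdist M (f s) (f t) \<and> mdist M (f s) (f t) \<le> b * dist s t)"

definition purely_1_unrectifiable :: "'a metric \<Rightarrow> bool" where
  "purely_1_unrectifiable M \<longleftrightarrow>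
     \<not> (\<exists>S f. S \<in> sets lebesgue \<and> emeasure lebesgue S > 0 \<and> bi_Lipschitz_on S M f)"


section \<open>Metric quotients of pseudometrics\<close>

definition pseudometric_on :: "'a set \<Rightarrow> ('a \<Rightarrow> 'a \<Rightarrow> real) \<Rightarrow> bool" where
  "pseudometric_on X p \<longleftrightarrow>
     (\<forall>x\<in>X. \<forall>y\<in>X. 0 \<le> p x y \<and> p x y = p y x) \<and> (\<forall>x\<in>X. p x x = 0) \<and>
     (\<forall>x\<in>X. \<forall>y\<in>X. \<forall>z\<in>X. p x z \<le> p x y + p y z)"

definition null_class :: "'a set \<Rightarrow> ('a \<Rightarrow> 'a \<Rightarrow> real) \<Rightarrow> 'a \<Rightarrow> 'a set" where
  "null_class X p x = {y \<in> X. p x y = 0}"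

text \<open>The value \<open>0\<close> off the carrier is there because \<^const>\<open>Metric_space\<close> requires the distance to
  be nonnegative and symmetric everywhere.\<close>

definition quotient_dist :: "'a set \<Rightarrow> ('a \<Rightarrow> 'a \<Rightarrow> real) \<Rightarrow> 'a set \<Rightarrow> 'a set \<Rightarrow> real" where
  "quotient_dist X p A B =
     (if A \<in> null_class X p ` X \<and> B \<in> null_class X p ` X
      then p (SOME x. x \<in> A) (SOME y. y \<in> B) else 0)"

definition quotient_metric :: "'a set \<Rightarrow> ('a \<Rightarrow> 'a \<Rightarrow> real) \<Rightarrow> 'a set metric" where
  "quotient_metric X p = metric (null_class X p ` X, quotient_dist X p)"

lemma quotient_dist_class:
  assumes "pseudometric_on X p" "x \<in> X" "y \<in> X"
  shows "quotient_dist X p (null_class X p x) (null_class X p y) = p x y"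
proof -
  define u where "u = (SOME u. u \<in> null_class X p x)"
  define v where "v = (SOME v. v \<in> null_class X p y)"
  have "x \<in> null_class X p x" "y \<in> null_class X p y"
    using assms by (auto simp: null_class_def pseudometric_on_def)
  then have "u \<in> null_class X p x" "v \<in> null_class X p y"
    unfolding u_def v_def by (auto intro: someI)
  then have uv: "u \<in> X" "v \<in> X" "p x u = 0" "p y v = 0"
    by (auto simp: null_class_def)
  have tri: "\<And>a b c. a \<in> X \<Longrightarrow> b \<in> X \<Longrightarrow> c \<in> X \<Longrightarrow> p a c \<le> p a b + p b c"
    and sym: "\<And>a b. a \<in> X \<Longrightarrow> b \<in> X \<Longrightarrow> p a b = p b a"
    using assms(1) by (auto simp: pseudometric_on_def)
  have "p u v = p x y"
    using tri[of u x v] tri[of x y v] tri[of x u y] tri[of u v y] sym[of u x] sym[of v y] uv assms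
    by linarith
  then show ?thesis
    using assms unfolding quotient_dist_def u_def v_def by simp
qed

lemma Metric_space_quotient:
  assumes "pseudometric_on X p"
  shows "Metric_space (null_class X p ` X) (quotient_dist X p)"
proof
  note cl = quotient_dist_class[OF assms]
  have nn: "\<And>x y. x \<in> X \<Longrightarrow> y \<in> X \<Longrightarrow> 0 \<le> p x y"
    and sym: "\<And>x y. x \<in> X \<Longrightarrow> y \<in> X \<Longrightarrow> p x y = p y x"
    and tri: "\<And>x y z. x \<in> X \<Longrightarrow> y \<in> X \<Longrightarrow> z \<in> X \<Longrightarrow> p x z \<le> p x y + p y z"
    and refl: "\<And>x. x \<in> X \<Longrightarrow> p x x = 0"
    using assms by (auto simp: pseudometric_on_def)
  show "0 \<le> quotient_dist X p A B" for A B
  proof (cases "A \<in> null_class X p ` X \<and> B \<in> null_class X p ` X")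
    case True
    then show ?thesis using cl nn by auto
  qed (auto simp: quotient_dist_def)
  show "quotient_dist X p A B = quotient_dist X p B A" for A B
  proof (cases "A \<in> null_class X p ` X \<and> B \<in> null_class X p ` X")
    case True
    then show ?thesis using cl sym by auto
  qed (auto simp: quotient_dist_def)
  show "quotient_dist X p A B = 0 \<longleftrightarrow> A = B"
    if AB: "A \<in> null_class X p ` X" "B \<in> null_class X p ` X" for A B
  proof -
    obtain x y where xy: "x \<in> X" "y \<in> X" "A = null_class X p x" "B = null_class X p y"
      using AB by auto
    have "A = B" if "p x y = 0"
    proof -
      have "p x z = 0 \<longleftrightarrow> p y z = 0" if "z \<in> X" for z
        using tri[of x y z] tri[of y x z] sym[of x y] nn[of x z] nn[of y z] that xy \<open>p x y = 0\<close>
        by linarith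
      then show ?thesis
        using xy by (auto simp: null_class_def)
    qed
    moreover have "p x y = 0" if "A = B"
    proof -
      have "y \<in> null_class X p y"
        using xy refl by (auto simp: null_class_def)
      then show ?thesis
        using that xy by (auto simp: null_class_def)
    qed
    ultimately show ?thesis
      using cl xy by auto
  qed
  show "quotient_dist X p A C \<le> quotient_dist X p A B + quotient_dist X p B C"
    if "A \<in> null_class X p ` X" "B \<in> null_class X p ` X" "C \<in> null_class X p ` X" for A B C
    using that tri by (auto simp: cl)
qed

lemma mspace_quotient_metric:
  "pseudometric_on X p \<Longrightarrow> mspace (quotient_metric X p) = null_class X p ` X"
  unfolding quotient_metric_def by (rule Metric_space.mspace_metric[OF Metric_space_quotient])

lemma mdist_quotient_metric:
  assumes "pseudometric_on X p" "x \<in> X" "y \<in> X"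
  shows "mdist (quotient_metric X p) (null_class X p x) (null_class X p y) = p x y"
  using quotient_dist_class[OF assms] Metric_space.mdist_metric[OF Metric_space_quotient[OF assms(1)]]
  by (simp add: quotient_metric_def)


section \<open>Curve-flat quotients\<close>

text \<open>The requirement \<open>K \<noteq> {}\<close> makes \<open>Inf K\<close> and \<open>Sup K\<close> the minimum and the maximum of the
  compact set \<open>K\<close>.\<close>

definition one_Lipschitz_fragment :: "'a metric \<Rightarrow> real set \<Rightarrow> (real \<Rightarrow> 'a) \<Rightarrow> bool" where
  "one_Lipschitz_fragment M K \<phi> \<longleftrightarrow> compact K \<and> K \<noteq> {} \<and> \<phi> \<in> K \<rightarrow> mspace M \<and>
     (\<forall>s\<in>K. \<forall>t\<in>K. mdist M (\<phi> s) (\<phi> t) \<le> dist s t)"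

definition curve_flat_dist :: "'a metric \<Rightarrow> 'a \<Rightarrow> 'a \<Rightarrow> real" where
  "curve_flat_dist M x y = Inf {measure lebesgue ({Inf K..Sup K} - K) | K \<phi>.
     one_Lipschitz_fragment M K \<phi> \<and> \<phi> (Inf K) = x \<and> \<phi> (Sup K) = y}"

lemma one_Lipschitz_fragment_space:
  assumes "one_Lipschitz_fragment M K \<phi>"
  shows "Inf K \<in> K" "Sup K \<in> K" "Inf K \<le> Sup K" "\<And>s. s \<in> K \<Longrightarrow> Inf K \<le> s \<and> s \<le> Sup K"
    "\<phi> (Inf K) \<in> mspace M" "\<phi> (Sup K) \<in> mspace M"
proof -
  have K: "compact K" "K \<noteq> {}" "\<phi> \<in> K \<rightarrow> mspace M"
    using assms by (auto simp: one_Lipschitz_fragment_def)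
  have bdd: "bdd_below K" "bdd_above K"
    using K by (auto intro: bounded_imp_bdd_below bounded_imp_bdd_above compact_imp_bounded)
  show *: "Inf K \<in> K" "Sup K \<in> K"
    using K bdd closed_contains_Inf closed_contains_Sup compact_imp_closed by blast+
  show bd: "\<And>s. s \<in> K \<Longrightarrow> Inf K \<le> s \<and> s \<le> Sup K"
    using bdd by (simp add: cInf_lower cSup_upper)
  show "Inf K \<le> Sup K"
    using * bd by blast
  show "\<phi> (Inf K) \<in> mspace M" "\<phi> (Sup K) \<in> mspace M"
    using * K by auto
qed

lemma curve_flat_dist_le:
  assumes "one_Lipschitz_fragment M K \<phi>" "\<phi> (Inf K) = x" "\<phi> (Sup K) = y"
  shows "curve_flat_dist M x y \<le> measure lebesgue ({Inf K..Sup K} - K)"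
  unfolding curve_flat_dist_def
proof (rule cInf_lower)
  show "bdd_below {measure lebesgue ({Inf K..Sup K} - K) | K \<phi>.
     one_Lipschitz_fragment M K \<phi> \<and> \<phi> (Inf K) = x \<and> \<phi> (Sup K) = y}"
    by (rule bdd_belowI[of _ 0]) auto
qed (use assms in blast)

lemma two_point_fragment:
  assumes "x \<in> mspace M" "y \<in> mspace M"
  shows "\<exists>K \<phi>. one_Lipschitz_fragment M K \<phi> \<and> \<phi> (Inf K) = x \<and> \<phi> (Sup K) = y \<and>
    measure lebesgue ({Inf K..Sup K} - K) \<le> mdist M x y"
proof -
  let ?d = "mdist M x y"
  let ?K = "{0, ?d}"
  let ?f = "\<lambda>s. if s = 0 then x else y"
  have diag: "mdist M x x = 0" "mdist M y y = 0"
    using assms by auto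
  have IS: "Inf ?K = 0" "Sup ?K = ?d"
    by (simp_all add: cInf_eq_Min cSup_eq_Max)
  have "one_Lipschitz_fragment M ?K ?f"
    using assms by (auto simp: one_Lipschitz_fragment_def dist_real_def diag mdist_commute)
  moreover have "?f 0 = x" "?f ?d = y"
    using assms by auto
  moreover have "measure lebesgue ({0..?d} - ?K) \<le> measure lebesgue {0..?d}"
    by (rule measure_mono_fmeasurable) (auto intro!: sets.Diff fmeasurableD)
  then have "measure lebesgue ({0..?d} - ?K) \<le> ?d"
    by simp
  ultimately show ?thesis
    using IS by (intro exI[of _ ?K] exI[of _ ?f]) simp
qed

lemma curve_flat_dist_approx:
  assumes "x \<in> mspace M" "y \<in> mspace M" "e > 0"
  shows "\<exists>K \<phi>. one_Lipschitz_fragment M K \<phi> \<and> \<phi> (Inf K) = x \<and> \<phi> (Sup K) = y \<and>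
    measure lebesgue ({Inf K..Sup K} - K) < curve_flat_dist M x y + e"
proof -
  let ?S = "{measure lebesgue ({Inf K..Sup K} - K) | K \<phi>.
     one_Lipschitz_fragment M K \<phi> \<and> \<phi> (Inf K) = x \<and> \<phi> (Sup K) = y}"
  have "?S \<noteq> {}"
    using two_point_fragment[OF assms(1,2)] by blast
  moreover have "Inf ?S < curve_flat_dist M x y + e"
    using assms by (simp add: curve_flat_dist_def)
  ultimately have "\<exists>s\<in>?S. s < curve_flat_dist M x y + e"
    by (rule cInf_lessD)
  then obtain K \<phi> where "one_Lipschitz_fragment M K \<phi>" "\<phi> (Inf K) = x" "\<phi> (Sup K) = y"
    "measure lebesgue ({Inf K..Sup K} - K) < curve_flat_dist M x y + e"
    by auto
  then show ?thesis
    by (intro exI[of _ K] exI[of _ \<phi>] conjI)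
qed

lemma curve_flat_dist_nonneg:
  assumes "x \<in> mspace M" "y \<in> mspace M"
  shows "0 \<le> curve_flat_dist M x y"
  unfolding curve_flat_dist_def
  by (rule cInf_greatest) (use two_point_fragment[OF assms] in auto)

lemma curve_flat_dist_le_mdist:
  assumes "x \<in> mspace M" "y \<in> mspace M"
  shows "curve_flat_dist M x y \<le> mdist M x y"
  using two_point_fragment[OF assms] by (meson curve_flat_dist_le order_trans)

lemma curve_flat_dist_commute_le:
  assumes "x \<in> mspace M" "y \<in> mspace M"
  shows "curve_flat_dist M y x \<le> curve_flat_dist M x y"
proof (rule field_le_epsilon)
  fix e :: real assume "e > 0"
  then obtain K \<phi> where K: "one_Lipschitz_fragment M K \<phi>" "\<phi> (Inf K) = x" "\<phi> (Sup K) = y"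
    and lt: "measure lebesgue ({Inf K..Sup K} - K) < curve_flat_dist M x y + e"
    using curve_flat_dist_approx[OF assms] by blast
  note sp = one_Lipschitz_fragment_space[OF K(1)]
  let ?K = "uminus ` K"
  have IS: "Inf ?K = - Sup K" "Sup ?K = - Inf K"
    using sp by (auto intro!: cInf_eq_minimum cSup_eq_maximum)
  have "one_Lipschitz_fragment M ?K (\<lambda>s. \<phi> (- s))"
    using K(1) by (auto simp: one_Lipschitz_fragment_def dist_minus compact_negations)
  then have "curve_flat_dist M y x \<le> measure lebesgue ({Inf ?K..Sup ?K} - ?K)"
    by (rule curve_flat_dist_le) (use K IS in simp_all)
  also have "{Inf ?K..Sup ?K} - ?K = uminus ` ({Inf K..Sup K} - K)"
    unfolding IS by (simp add: image_set_diff)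
  also have "measure lebesgue \<dots> = measure lebesgue ({Inf K..Sup K} - K)"
    using measure_lebesgue_affine[of "-1" 0 "{Inf K..Sup K} - K"] by simp
  finally show "curve_flat_dist M y x \<le> curve_flat_dist M x y + e"
    using lt by simp
qed

lemma curve_flat_dist_triangle:
  assumes "x \<in> mspace M" "y \<in> mspace M" "z \<in> mspace M"
  shows "curve_flat_dist M x z \<le> curve_flat_dist M x y + curve_flat_dist M y z"
proof (rule field_le_epsilon)
  fix e :: real assume "e > 0"
  then have e2: "e / 2 > 0"
    by simp
  obtain K \<phi> where K: "one_Lipschitz_fragment M K \<phi>" "\<phi> (Inf K) = x" "\<phi> (Sup K) = y"
    and ltK: "measure lebesgue ({Inf K..Sup K} - K) < curve_flat_dist M x y + e/2"
    using curve_flat_dist_approx[OF assms(1,2) e2] by blast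
  obtain L \<psi> where L: "one_Lipschitz_fragment M L \<psi>" "\<psi> (Inf L) = y" "\<psi> (Sup L) = z"
    and ltL: "measure lebesgue ({Inf L..Sup L} - L) < curve_flat_dist M y z + e/2"
    using curve_flat_dist_approx[OF assms(2,3) e2] by blast
  note spK = one_Lipschitz_fragment_space[OF K(1)] and spL = one_Lipschitz_fragment_space[OF L(1)]
  define t where "t = Sup K - Inf L"
  let ?L = "(+) t ` L"
  let ?KL = "K \<union> ?L"
  define f where "f s = (if s \<le> Sup K then \<phi> s else \<psi> (s - t))" for s
  have ends: "Inf K \<le> s \<and> s \<le> t + Sup L" if "s \<in> ?KL" for s
    using that
  proof
    assume "s \<in> K"
    then show ?thesis
      using spK(4)[of s] spL(3) by (simp add: t_def)
  next
    assume "s \<in> ?L"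
    then obtain l where "l \<in> L" "s = t + l"
      by blast
    then show ?thesis
      using spL(4)[of l] spK(3) by (simp add: t_def)
  qed
  have IS: "Inf ?KL = Inf K" "Sup ?KL = t + Sup L"
    using spK(1) spL(2) ends by (auto intro!: cInf_eq_minimum cSup_eq_maximum simp del: image_Un)
  have fK: "f s = \<phi> s" if "s \<in> K" for s
    using that spK by (simp add: f_def)
  have fL: "f (t + s) = \<psi> s" if "s \<in> L" for s
  proof (cases "s = Inf L")
    case True
    then show ?thesis
      using K L by (simp add: f_def t_def)
  next
    case False
    then have "Inf L < s"
      using that spL by (simp add: order_less_le)
    then show ?thesis
      by (simp add: f_def t_def)
  qed
  have lipK: "\<And>a b. a \<in> K \<Longrightarrow> b \<in> K \<Longrightarrow> mdist M (\<phi> a) (\<phi> b) \<le> dist a b"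
    and lipL: "\<And>a b. a \<in> L \<Longrightarrow> b \<in> L \<Longrightarrow> mdist M (\<psi> a) (\<psi> b) \<le> dist a b"
    and mapK: "\<And>a. a \<in> K \<Longrightarrow> \<phi> a \<in> mspace M" and mapL: "\<And>a. a \<in> L \<Longrightarrow> \<psi> a \<in> mspace M"
    and cpt: "compact K" "compact L"
    using K(1) L(1) by (auto simp: one_Lipschitz_fragment_def)
  have cross: "mdist M (\<phi> a) (\<psi> b) \<le> dist a (t + b)" if ab: "a \<in> K" "b \<in> L" for a b
  proof -
    have "mdist M (\<phi> a) (\<psi> b) \<le> mdist M (\<phi> a) y + mdist M y (\<psi> b)"
      using ab mapK mapL assms by (intro mdist_triangle) auto
    also have "\<dots> \<le> dist a (Sup K) + dist (Inf L) b"
      using lipK[OF ab(1) spK(2)] lipL[OF spL(1) ab(2)] K L by simp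
    also have "\<dots> = dist a (t + b)"
      using spK(4)[OF ab(1)] spL(4)[OF ab(2)] by (simp add: dist_real_def t_def)
    finally show ?thesis .
  qed
  have "one_Lipschitz_fragment M ?KL f"
    unfolding one_Lipschitz_fragment_def
  proof (intro conjI ballI)
    show "compact ?KL"
      using cpt by (intro compact_Un compact_translation)
    show "?KL \<noteq> {}"
      using spK by blast
    show "f \<in> ?KL \<rightarrow> mspace M"
      using fK fL mapK mapL by auto
    show "mdist M (f a) (f b) \<le> dist a b" if "a \<in> ?KL" "b \<in> ?KL" for a b
      using that
    proof (elim UnE imageE)
      fix a' b' assume "a = t + a'" "a' \<in> L" "b \<in> K"
      then show ?thesis
        using cross[of b a'] by (simp add: fK fL mdist_commute dist_commute)
    next
      fix a' b' assume "a = t + a'" "a' \<in> L" "b = t + b'" "b' \<in> L"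
      then show ?thesis
        using lipL[of a' b'] by (simp add: fL)
    qed (use lipK cross in \<open>simp_all add: fK fL\<close>)
  qed
  moreover have "f (Inf K) = x"
    using fK spK K by simp
  moreover have "f (t + Sup L) = z"
    using fL spL L by simp
  ultimately have "curve_flat_dist M x z \<le> measure lebesgue ({Inf K..t + Sup L} - ?KL)"
    using curve_flat_dist_le[of M ?KL f x z] IS by simp
  also have "\<dots> \<le> measure lebesgue (({Inf K..Sup K} - K) \<union> (+) t ` ({Inf L..Sup L} - L))"
  proof (rule measure_mono_fmeasurable)
    have "s - t \<in> {Inf L..Sup L} - L" if "s \<in> {Inf K..t + Sup L} - ?KL" "\<not> s \<le> Sup K" for s
    proof -
      have "s - t \<notin> L"
        using that by (auto simp: image_iff)
      then show ?thesis
        using that by (auto simp: t_def)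
    qed
    then show "{Inf K..t + Sup L} - ?KL \<subseteq> ({Inf K..Sup K} - K) \<union> (+) t ` ({Inf L..Sup L} - L)"
      by (force simp: image_iff)
    show "{Inf K..t + Sup L} - ?KL \<in> sets lebesgue"
      using cpt by (intro sets.Diff sets.Un fmeasurableD measurable_translation lmeasurable_compact) auto
    show "({Inf K..Sup K} - K) \<union> (+) t ` ({Inf L..Sup L} - L) \<in> lmeasurable"
      using cpt by (intro fmeasurable.Un measurable_translation fmeasurable.Diff lmeasurable_compact) auto
  qed
  also have "\<dots> \<le> measure lebesgue ({Inf K..Sup K} - K)
      + measure lebesgue ((+) t ` ({Inf L..Sup L} - L))"
    using cpt
    by (intro measure_Un_le fmeasurableD measurable_translation fmeasurable.Diff lmeasurable_compact) auto
  also have "measure lebesgue ((+) t ` ({Inf L..Sup L} - L)) = measure lebesgue ({Inf L..Sup L} - L)"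
    by (rule measure_translation)
  finally show "curve_flat_dist M x z \<le> curve_flat_dist M x y + curve_flat_dist M y z + e"
    using ltK ltL by simp
qed

lemma pseudometric_curve_flat_dist: "pseudometric_on (mspace M) (curve_flat_dist M)"
  unfolding pseudometric_on_def
proof (intro conjI ballI)
  show "curve_flat_dist M x x = 0" if "x \<in> mspace M" for x
  proof -
    have "mdist M x x = 0"
      using that by simp
    then show ?thesis
      using curve_flat_dist_le_mdist[of x M x] curve_flat_dist_nonneg[of x M x] that by linarith
  qed
  show "0 \<le> curve_flat_dist M x y" if "x \<in> mspace M" "y \<in> mspace M" for x y
    using that by (rule curve_flat_dist_nonneg)
  show "curve_flat_dist M x y = curve_flat_dist M y x" if "x \<in> mspace M" "y \<in> mspace M" for x y
    using that by (intro antisym curve_flat_dist_commute_le)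
  show "curve_flat_dist M x z \<le> curve_flat_dist M x y + curve_flat_dist M y z"
    if "x \<in> mspace M" "y \<in> mspace M" "z \<in> mspace M" for x y z
    using that by (rule curve_flat_dist_triangle)
qed

definition curve_flat_step :: "'a set \<Rightarrow> ('a \<Rightarrow> 'a \<Rightarrow> real) \<Rightarrow> 'a \<Rightarrow> 'a \<Rightarrow> real" where
  "curve_flat_step X p x y =
     curve_flat_dist (quotient_metric X p) (null_class X p x) (null_class X p y)"

text \<open>\<open>curve_flat_iter M \<alpha>\<close> is the \<open>\<alpha>\<close>-th iterated curve-flat distance, regarded as a pseudometric
  on \<open>M\<close>, and \<open>curve_flat_quotient M \<alpha>\<close> is the \<open>\<alpha>\<close>-th iterated curve-flat quotient, represented for
  every \<open>\<alpha>\<close> as a set of equivalence classes in \<open>M\<close>; for \<open>\<alpha> = 0\<close> these classes are the singletons.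
  The recursion equations in the zero, successor and limit cases are lemmas below.\<close>

function curve_flat_iter :: "'a metric \<Rightarrow> 'o::wellorder \<Rightarrow> 'a \<Rightarrow> 'a \<Rightarrow> real" where
  "curve_flat_iter M \<alpha> =
     (if \<forall>\<beta>. \<alpha> \<le> \<beta> then mdist M
      else if \<exists>\<beta>. is_pred \<beta> \<alpha> then
        curve_flat_step (mspace M) (curve_flat_iter M (THE \<beta>. is_pred \<beta> \<alpha>))
      else (\<lambda>x y. INF \<beta>\<in>{..<\<alpha>}. curve_flat_iter M \<beta> x y))"
  by auto
termination
proof (relation "inv_image {(\<beta>, \<alpha>). \<beta> < \<alpha>} snd")
  show "wf (inv_image {(\<beta>, \<alpha> :: 'o::wellorder). \<beta> < \<alpha>} (snd :: 'a metric \<times> 'o \<Rightarrow> 'o))"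
    by (intro wf_inv_image wf)
  show "((M, THE \<beta>. is_pred \<beta> \<alpha>), M, \<alpha>) \<in> inv_image {(\<beta>, \<alpha>). \<beta> < \<alpha>} snd"
    if ex: "\<exists>\<beta>. is_pred \<beta> \<alpha>" for M :: "'a metric" and \<alpha> :: "'o::wellorder"
  proof -
    obtain \<beta> where \<beta>: "is_pred \<beta> \<alpha>"
      using ex by blast
    then have "\<beta> < \<alpha>"
      by (simp add: is_pred_def)
    then show ?thesis
      by (simp add: is_pred_the[OF \<beta>])
  qed
qed auto

declare curve_flat_iter.simps [simp del]

lemma curve_flat_iter_zero:
  "(\<And>\<beta>. \<alpha> \<le> \<beta>) \<Longrightarrow> curve_flat_iter M \<alpha> = mdist M"
  by (simp add: curve_flat_iter.simps)

lemma curve_flat_iter_succ: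
  assumes "is_pred \<beta> \<alpha>"
  shows "curve_flat_iter M \<alpha> = curve_flat_step (mspace M) (curve_flat_iter M \<beta>)"
proof -
  have "\<not> (\<forall>\<beta>. \<alpha> \<le> \<beta>)"
    using assms by (auto simp: is_pred_def not_le)
  then show ?thesis
    using assms is_pred_the[OF assms] by (subst curve_flat_iter.simps) auto
qed

lemma curve_flat_iter_limit:
  assumes "\<beta> < \<alpha>" "\<And>\<gamma>. \<not> is_pred \<gamma> \<alpha>"
  shows "curve_flat_iter M \<alpha> x y = (INF \<gamma>\<in>{..<\<alpha>}. curve_flat_iter M \<gamma> x y)"
proof -
  have "\<not> (\<forall>\<beta>. \<alpha> \<le> \<beta>)"
    using assms by (auto simp: not_le)
  then show ?thesis
    using assms by (subst curve_flat_iter.simps) auto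
qed

lemma curve_flat_step_le:
  assumes "pseudometric_on X p" "x \<in> X" "y \<in> X"
  shows "curve_flat_step X p x y \<le> p x y"
  using curve_flat_dist_le_mdist[of "null_class X p x" "quotient_metric X p" "null_class X p y"] assms
  by (simp add: curve_flat_step_def mspace_quotient_metric mdist_quotient_metric)

lemma pseudometric_curve_flat_step:
  assumes "pseudometric_on X p"
  shows "pseudometric_on X (curve_flat_step X p)"
  using pseudometric_curve_flat_dist[of "quotient_metric X p"] mspace_quotient_metric[OF assms]
  by (simp add: pseudometric_on_def curve_flat_step_def)

lemma pseudometric_curve_flat_iter_antimono:
  fixes \<alpha> :: "'o::wellorder"
  shows "pseudometric_on (mspace M) (curve_flat_iter M \<alpha>) \<and>
    (\<forall>\<beta><\<alpha>. \<forall>x\<in>mspace M. \<forall>y\<in>mspace M. curve_flat_iter M \<alpha> x y \<le> curve_flat_iter M \<beta> x y)"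
proof (induction \<alpha> rule: less_induct)
  case (less \<alpha>)
  let ?X = "mspace M" and ?d = "curve_flat_iter M"
  have ps: "\<beta> < \<alpha> \<Longrightarrow> pseudometric_on ?X (?d \<beta>)" for \<beta>
    using less by blast
  have mono: "?d \<beta> x y \<le> ?d \<gamma> x y" if "\<gamma> \<le> \<beta>" "\<beta> < \<alpha>" "x \<in> ?X" "y \<in> ?X" for \<beta> \<gamma> x y
    using less[of \<beta>] that by (cases "\<gamma> = \<beta>") auto
  consider (zero) "\<forall>\<beta>. \<alpha> \<le> \<beta>" | (succ) \<beta> where "is_pred \<beta> \<alpha>"
    | (limit) \<beta>0 where "\<beta>0 < \<alpha>" "\<And>\<gamma>. \<not> is_pred \<gamma> \<alpha>"
  proof (cases "\<exists>\<beta>. is_pred \<beta> \<alpha>")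
    case True
    with succ show thesis by blast
  next
    case False
    with zero limit show thesis unfolding not_le[symmetric] by blast
  qed
  then show ?case
  proof cases
    case zero
    then have "?d \<alpha> = mdist M" "\<And>\<beta>. \<not> \<beta> < \<alpha>"
      using curve_flat_iter_zero[of \<alpha>] by (auto simp: not_less)
    then show ?thesis
      by (auto simp: pseudometric_on_def mdist_commute mdist_triangle)
  next
    case succ
    then have \<beta>: "\<beta> < \<alpha>" "\<And>\<gamma>. \<gamma> < \<alpha> \<Longrightarrow> \<gamma> \<le> \<beta>" and eq: "?d \<alpha> = curve_flat_step ?X (?d \<beta>)"
      using curve_flat_iter_succ[OF succ] by (auto simp: is_pred_def)
    have "?d \<alpha> x y \<le> ?d \<gamma> x y" if "\<gamma> < \<alpha>" "x \<in> ?X" "y \<in> ?X" for \<gamma> x y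
      using curve_flat_step_le[OF ps[OF \<beta>(1)]] mono[of \<gamma> \<beta> x y] \<beta> that eq by fastforce
    then show ?thesis
      using pseudometric_curve_flat_step[OF ps[OF \<beta>(1)]] eq by auto
  next
    case limit
    have eq: "?d \<alpha> x y = (INF \<gamma>\<in>{..<\<alpha>}. ?d \<gamma> x y)" for x y
      using curve_flat_iter_limit[OF limit] .
    have nn: "\<gamma> < \<alpha> \<Longrightarrow> x \<in> ?X \<Longrightarrow> y \<in> ?X \<Longrightarrow> 0 \<le> ?d \<gamma> x y" for \<gamma> x y
      using ps by (auto simp: pseudometric_on_def)
    have le: "?d \<alpha> x y \<le> ?d \<gamma> x y" if "\<gamma> < \<alpha>" "x \<in> ?X" "y \<in> ?X" for \<gamma> x y
      unfolding eq by (rule cINF_lower[OF bdd_belowI2[of _ 0]]) (use nn that in auto)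
    have ge: "c \<le> ?d \<alpha> x y" if "\<And>\<gamma>. \<gamma> < \<alpha> \<Longrightarrow> c \<le> ?d \<gamma> x y" for c x y
      unfolding eq by (rule cINF_greatest) (use limit that in auto)
    have approx: "\<exists>\<gamma><\<alpha>. ?d \<gamma> x y < ?d \<alpha> x y + e" if "e > 0" for x y e
      using ge[of "?d \<alpha> x y + e" x y] that by (force simp: not_less)
    have "pseudometric_on ?X (?d \<alpha>)"
      unfolding pseudometric_on_def
    proof (intro conjI ballI)
      show "0 \<le> ?d \<alpha> x y" if "x \<in> ?X" "y \<in> ?X" for x y
        using ge nn that by blast
      show "?d \<alpha> x y = ?d \<alpha> y x" if "x \<in> ?X" "y \<in> ?X" for x y
        unfolding eq by (rule INF_cong) (use ps that in \<open>auto simp: pseudometric_on_def\<close>)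
      show "?d \<alpha> x x = 0" if "x \<in> ?X" for x
      proof (rule antisym)
        have "?d \<beta>0 x x = 0"
          using ps[OF limit(1)] that by (auto simp: pseudometric_on_def)
        then show "?d \<alpha> x x \<le> 0"
          using le[OF limit(1) that that] by simp
        show "0 \<le> ?d \<alpha> x x"
          using ge nn that by blast
      qed
      show "?d \<alpha> x z \<le> ?d \<alpha> x y + ?d \<alpha> y z" if xyz: "x \<in> ?X" "y \<in> ?X" "z \<in> ?X" for x y z
      proof (rule field_le_epsilon)
        fix e :: real assume "e > 0"
        then obtain \<gamma> \<delta> where gd: "\<gamma> < \<alpha>" "\<delta> < \<alpha>"
          "?d \<gamma> x y < ?d \<alpha> x y + e/2" "?d \<delta> y z < ?d \<alpha> y z + e/2"
          using approx[of "e/2" x y] approx[of "e/2" y z] by auto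
        define m where "m = max \<gamma> \<delta>"
        have m: "m < \<alpha>" "\<gamma> \<le> m" "\<delta> \<le> m"
          using gd by (auto simp: m_def)
        have "?d \<alpha> x z \<le> ?d m x z"
          using le m xyz by blast
        also have "\<dots> \<le> ?d m x y + ?d m y z"
          using ps[OF m(1)] xyz by (auto simp: pseudometric_on_def)
        also have "\<dots> \<le> ?d \<gamma> x y + ?d \<delta> y z"
          using mono m xyz by (intro add_mono) auto
        finally show "?d \<alpha> x z \<le> ?d \<alpha> x y + ?d \<alpha> y z + e"
          using gd by simp
      qed
    qed
    then show ?thesis
      using le by blast
  qed
qed

lemmas pseudometric_curve_flat_iter = pseudometric_curve_flat_iter_antimono[THEN conjunct1]

definition curve_flat_quotient :: "'a metric \<Rightarrow> 'o::wellorder \<Rightarrow> 'a set metric" where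
  "curve_flat_quotient M \<alpha> = quotient_metric (mspace M) (curve_flat_iter M \<alpha>)"

lemma mspace_curve_flat_quotient:
  "mspace (curve_flat_quotient M \<alpha>) = null_class (mspace M) (curve_flat_iter M \<alpha>) ` mspace M"
  by (simp add: curve_flat_quotient_def mspace_quotient_metric pseudometric_curve_flat_iter)

lemma mdist_curve_flat_quotient:
  assumes "x \<in> mspace M" "y \<in> mspace M"
  shows "mdist (curve_flat_quotient M \<alpha>) (null_class (mspace M) (curve_flat_iter M \<alpha>) x)
    (null_class (mspace M) (curve_flat_iter M \<alpha>) y) = curve_flat_iter M \<alpha> x y"
  using assms by (simp add: curve_flat_quotient_def mdist_quotient_metric pseudometric_curve_flat_iter)

text \<open>For compact \<open>M\<close> the least ordinal exists and is countable: the iterated curve-flat distances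
  form a decreasing family of continuous functions on a separable space, so they stabilize at a
  countable ordinal, and a metric space on which the curve-flat distance agrees with the original one
  is purely 1-unrectifiable.  So the result does not depend on the choice of the infinite type \<open>'u\<close>.\<close>

definition curve_flat_index :: "'a metric \<Rightarrow> 'u::infinite ordinal" where
  "curve_flat_index M = (LEAST \<alpha>. purely_1_unrectifiable (curve_flat_quotient M \<alpha>))"

end

theory Submission
  imports Defs
begin

text \<open>Let \<open>f : M \<rightarrow> N\<close> be a Lipschitz quotient map.  By transfinite induction \<open>f\<close> is Lipschitz and
  co-Lipschitz, with unchanged constants, for every pair of iterated curve-flat distances on \<open>M\<close> and
  \<open>N\<close>: curve fragments push forward along \<open>f\<close>, and by compactness of \<open>M\<close> they lift along \<open>f\<close> with a
  prescribed starting point.  The same lifting turns a bi-Lipschitz copy of a compact set of positive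
  measure in the \<open>\<alpha>\<close>-th quotient of \<open>N\<close> into one in the \<open>\<alpha>\<close>-th quotient of \<open>M\<close>.  It remains to see that
  the index of \<open>M\<close> is attained, i.e. that the iterated distances of \<open>M\<close> stabilize at an ordinal
  in \<open>'u ordinal\<close>, and that stability forces pure 1-unrectifiability; the latter follows from the
  Lebesgue density theorem.\<close>

section \<open>Ordinals\<close>

lemma well_order_on_UNIV_le: "well_order_on UNIV {(x, y :: 'o::wellorder). x \<le> y}"
proof -
  have "{(x, y :: 'o). x \<le> y} - Id = {(x, y). x < y}"
    by auto
  then have "wf ({(x, y :: 'o). x \<le> y} - Id)"
    using wf by (rule ssubst)
  moreover have "linear_order {(x, y :: 'o). x \<le> y}"
    by (auto simp: linear_order_on_def partial_order_on_def preorder_on_def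
        refl_on_def trans_def antisym_def total_on_def)
  ultimately show ?thesis
    by (simp add: well_order_on_def)
qed

text \<open>If \<open>'u ordinal\<close> embedded into \<open>'u\<close>, then its own order type \<open>\<theta>\<close> would be a member of it, and
  the initial segment of \<open>\<theta>\<close> determined by \<open>\<theta>\<close> itself would have at least the order type \<open>\<theta>\<close>.\<close>

lemma not_inj_ordinal: "\<not> inj (j :: 'u ordinal \<Rightarrow> 'u)"
proof
  assume inj: "inj j"
  \<comment> \<open>\<open>r\<close> carries the order of all of \<open>'u ordinal\<close> over to
    \<open>'u\<close>, so its order type is itself one of the elements being ordered.\<close>
  define r where "r = dir_image {(x, y :: 'u ordinal). x \<le> y} j"
  have F: "Field {(x, y :: 'u ordinal). x \<le> y} = UNIV"
    by (auto simp: Field_def)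
  have wo: "Well_order r"
    unfolding r_def using well_order_on_UNIV_le inj F by (intro Well_order_dir_image) auto
  have Fr: "Field r = range j"
    unfolding r_def dir_image_Field F ..
  have rel: "(j a, j b) \<in> r \<longleftrightarrow> a \<le> b" for a b
    using inj by (auto simp: r_def dir_image_def inj_eq)
  \<comment> \<open>The part of \<open>r\<close> strictly below \<open>j a\<close>; being a
    well-order inside \<open>'u\<close>, it again represents an ordinal.\<close>
  define s where "s a = Restr r (underS r (j a))" for a
  have wrel: "wo_rel r"
    using wo by (simp add: wo_rel_def)
  have ofl: "wo_rel.ofilter r (underS r (j a))" for a
    using wrel by (rule wo_rel.underS_ofilter)
  have iso: "(s a, s a) \<in> ordIso" "(r, r) \<in> ordIso" for a
    unfolding s_def by (simp_all add: wo Well_order_Restr ordIso_reflexive)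
  have "(s b, s a) \<in> ordLess" if "b < a" for a b
  proof -
    have "underS r (j c) = j ` {..<c}" for c
    proof (intro set_eqI iffI)
      fix u assume "u \<in> underS r (j c)"
      then have u: "u \<noteq> j c" "(u, j c) \<in> r"
        by (auto simp: underS_def)
      then obtain d where "u = j d"
        using Fr by (metis FieldI1 imageE)
      then show "u \<in> j ` {..<c}"
        using u rel by (auto simp: order_less_le)
    next
      fix u assume "u \<in> j ` {..<c}"
      then obtain d where "u = j d" "d < c"
        by blast
      then show "u \<in> underS r (j c)"
        using inj by (auto simp: underS_def rel inj_eq)
    qed
    moreover have "{..<b} \<subset> {..<a}"
      using that by auto
    ultimately have "underS r (j b) \<subset> underS r (j a)"
      using inj by (simp add: inj_image_subset_iff psubset_eq inj_image_eq_iff)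
    then show ?thesis
      unfolding s_def using ofilter_subset_ordLess[OF wo ofl ofl] by blast
  qed
  then have mono: "abs_ordinal (s b) < abs_ordinal (s a)" if "b < a" for a b
    using that less_ordinal.abs_eq[OF iso(1) iso(1)] by blast
  \<comment> \<open>A strictly increasing self-map of a well-order never goes below the identity:
    otherwise a counterexample would be sent to a smaller counterexample.\<close>
  have ge: "a \<le> abs_ordinal (s a)" for a
  proof (induction a rule: less_induct)
    case (less a)
    show ?case
    proof (rule ccontr)
      assume "\<not> a \<le> abs_ordinal (s a)"
      then have "abs_ordinal (s a) < a"
        by simp
      from less[OF this] mono[OF this] show False
        by (meson leD)
    qed
  qed
  \<comment> \<open>At the order type of \<open>r\<close> itself, the segment is a proper initial
    segment of \<open>r\<close>, hence strictly shorter, against \<open>ge\<close>.\<close>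
  have "(s (abs_ordinal r), r) \<in> ordLess"
    unfolding s_def using wo Fr by (intro underS_Restr_ordLess) auto
  then have "abs_ordinal (s (abs_ordinal r)) < abs_ordinal r"
    using less_ordinal.abs_eq[OF iso(1) iso(2)] by blast
  then show False
    using ge leD by blast
qed

text \<open>An infinite \<open>'u\<close> contains a copy of the naturals, so a countable
  \<open>'u ordinal\<close> would embed into \<open>'u\<close>. Uncountability rules out an
  injection of all ordinals into countable data when the iterated distances are shown to
  stabilize.\<close>

lemma uncountable_ordinal: "\<not> countable (UNIV :: 'u::infinite ordinal set)"
proof
  assume "countable (UNIV :: 'u ordinal set)"
  then obtain g :: "'u ordinal \<Rightarrow> nat" where "inj g"
    by (auto simp: countable_def)
  moreover obtain h :: "nat \<Rightarrow> 'u" where "inj h"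
    using infinite_countable_subset[OF infinite_UNIV[where 'a = 'u]] by auto
  ultimately have "inj (h \<circ> g)"
    by (simp add: inj_compose)
  then show False
    using not_inj_ordinal by blast
qed

text \<open>A general well-ordered type may have a greatest element, and only that one lacks a
  successor. The successor of any other element is its least strict upper bound.\<close>

lemma exists_is_pred:
  fixes \<alpha> \<beta> :: "'o::wellorder"
  assumes "\<alpha> < \<beta>"
  obtains \<sigma> where "is_pred \<alpha> \<sigma>"
proof
  have "\<alpha> < (LEAST \<gamma>. \<alpha> < \<gamma>)"
    using assms by (rule LeastI)
  moreover have "\<gamma> \<le> \<alpha>" if "\<gamma> < (LEAST \<gamma>. \<alpha> < \<gamma>)" for \<gamma>
    using not_less_Least[OF that] by (simp add: not_less)
  ultimately show "is_pred \<alpha> (LEAST \<gamma>. \<alpha> < \<gamma>)"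
    by (simp add: is_pred_def)
qed

section \<open>Intervals almost filled by a compact set\<close>

text \<open>Inner regularity gives a closed subset missing little of \<open>S\<close>; cutting it
  with large balls makes it compact.\<close>

lemma compact_subset_positive_measure:
  fixes S :: "real set"
  assumes "S \<in> sets lebesgue" "emeasure lebesgue S > 0"
  obtains K where "compact K" "K \<subseteq> S" "measure lebesgue K > 0"
proof -
  \<comment> \<open>\<open>S\<close> may have infinite measure, so the tolerance is a finite
    positive number below it. If \<open>T\<close> were null, \<open>S - T\<close> would carry the
    whole measure of \<open>S\<close>, which exceeds this tolerance.\<close>
  obtain c where "0 < c" "c < emeasure lebesgue S"
    using assms(2) dense by blast
  then obtain e where e: "e > 0" "ennreal e < emeasure lebesgue S"
    by (cases c) auto
  obtain T where T: "closed T" "T \<subseteq> S" "S - T \<in> lmeasurable" "emeasure lebesgue (S - T) < ennreal e"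
    using sets_lebesgue_inner_closed[OF assms(1) e(1)] .
  define F where "F n = T \<inter> cball 0 (real n)" for n
  have F: "compact (F n)" "F n \<subseteq> T" for n
    using T(1) by (auto simp: F_def closed_Int_compact)
  have FT: "\<Union> (range F) = T"
    using real_arch_simple by (auto simp: F_def)
  have Fm: "F n \<in> lmeasurable" for n
    using F(1) by (rule lmeasurable_compact)
  have "\<exists>n. measure lebesgue (F n) > 0"
  proof (rule ccontr)
    assume "\<not> (\<exists>n. measure lebesgue (F n) > 0)"
    then have "measure lebesgue (F n) = 0" for n
      by (metis measure_nonneg order_le_less)
    then have "negligible (F n)" for n
      using Fm by (simp add: negligible_iff_measure)
    then have "negligible T"
      using negligible_countable_Union[of "range F"] FT by auto
    then have "emeasure lebesgue S = emeasure lebesgue (S - T)"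
      using assms(1) by (metis emeasure_Diff_null_set negligible_iff_null_sets)
    then show False
      using T(4) e(2) by simp
  qed
  then show ?thesis
    using that F T(2) by blast
qed

text \<open>A weak form of the Lebesgue density theorem, with the endpoints of the interval in the set.\<close>

lemma compact_almost_full_interval:
  fixes K :: "real set"
  assumes K: "compact K" "measure lebesgue K > 0" and \<epsilon>: "\<epsilon> > 0"
  obtains p q where "p \<in> K" "q \<in> K" "p < q" "measure lebesgue ({p..q} - K) < \<epsilon> * (q - p)"
proof (rule ccontr)
  let ?\<mu> = "measure (lebesgue :: real measure)"
  \<comment> \<open>The bound on the density of \<open>K\<close> in intervals if the claim fails;
    the maximum with 0 keeps it nonnegative when \<epsilon> > 1.\<close>
  define \<theta> where "\<theta> = max 0 (1 - \<epsilon>)"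
  have \<theta>: "0 \<le> \<theta>" "\<theta> < 1"
    using \<epsilon> by (auto simp: \<theta>_def)
  note Km = lmeasurable_compact[OF K(1)]
  note found = that
  assume "\<not> thesis"
  then have no: "\<epsilon> * (q - p) \<le> ?\<mu> ({p..q} - K)" if "p \<in> K" "q \<in> K" "p < q" for p q
    using found[OF that] not_less by blast
  \<comment> \<open>Shrinking the interval to the extreme points \<open>p\<close>, \<open>q\<close>
    of \<open>K\<close> in it loses nothing of \<open>K\<close> and puts the endpoints into
    \<open>K\<close>, where \<open>no\<close> applies.\<close>
  have sparse: "?\<mu> ({a..b} \<inter> K) \<le> \<theta> * ?\<mu> {a..b}" for a b
  proof (cases "{a..b} \<inter> K = {}")
    case True
    then show ?thesis
      using \<theta> by simp
  next
    case False
    have cp: "compact ({a..b} \<inter> K)"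
      using K by (simp add: compact_Int)
    have bdd: "bdd_below ({a..b} \<inter> K)" "bdd_above ({a..b} \<inter> K)"
      using cp by (simp_all add: compact_imp_bounded bounded_imp_bdd_below bounded_imp_bdd_above)
    define p where "p = Inf ({a..b} \<inter> K)"
    define q where "q = Sup ({a..b} \<inter> K)"
    have pq: "p \<in> {a..b} \<inter> K" "q \<in> {a..b} \<inter> K"
      unfolding p_def q_def using cp False bdd
      by (intro closed_contains_Inf closed_contains_Sup; simp add: compact_imp_closed)+
    have bd: "p \<le> s \<and> s \<le> q" if "s \<in> {a..b} \<inter> K" for s
      unfolding p_def q_def using bdd that by (auto intro: cInf_lower cSup_upper)
    have "?\<mu> ({a..b} \<inter> K) \<le> ?\<mu> ({p..q} \<inter> K)"
      using bd Km by (intro measure_mono_fmeasurable) (auto intro!: fmeasurable.Int sets.Int)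
    also have "\<dots> \<le> \<theta> * (q - p)"
    proof (cases "p < q")
      case True
      have "?\<mu> {p..q} = ?\<mu> ({p..q} \<inter> K) + ?\<mu> ({p..q} - K)"
        using measurable_measure_Diff[of "{p..q}" lebesgue "{p..q} \<inter> K"] fmeasurableD[OF Km]
        by (simp add: Diff_Int sets.Int)
      then have "?\<mu> ({p..q} \<inter> K) \<le> (1 - \<epsilon>) * (q - p)"
        using no[of p q] pq True by (simp add: algebra_simps)
      also have "\<dots> \<le> \<theta> * (q - p)"
        using True by (intro mult_right_mono) (auto simp: \<theta>_def)
      finally show ?thesis .
    next
      case False
      then have "{p..q} \<inter> K \<subseteq> {p}" "p = q"
        using bd[OF pq(1)] by auto
      then have "negligible ({p..q} \<inter> K)"
        using negligible_sing negligible_subset by blast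
      then show ?thesis
        using \<open>p = q\<close> by (simp add: negligible_imp_measure0)
    qed
    also have "\<dots> \<le> \<theta> * ?\<mu> {a..b}"
      using pq \<theta> by (intro mult_left_mono) auto
    finally show ?thesis .
  qed
  \<comment> \<open>Half of the deficit that the density bound enforces: a cover of \<open>K\<close>
    by intervals of total measure at most \<open>?\<mu> K + e\<close> will give
    \<open>(1 - \<theta>) * ?\<mu> K \<le> e\<close>, which is absurd.\<close>
  define e where "e = (1 - \<theta>) * ?\<mu> K / 2"
  have "e > 0"
    using \<theta> K by (simp add: e_def)
  obtain a b where "K \<subseteq> cbox a b"
    using bounded_subset_cbox_symmetric compact_imp_bounded[OF K(1)] by blast
  from measurable_outer_intervals_bounded[OF Km this \<open>e > 0\<close>]
  obtain \<D> where cD: "countable \<D>"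
    and box: "\<And>D. D \<in> \<D> \<Longrightarrow> D \<subseteq> cbox a b \<and> D \<noteq> {} \<and> (\<exists>c d. D = cbox c d)"
    and dis: "pairwise (\<lambda>A B. interior A \<inter> interior B = {}) \<D>"
    and cover: "K \<subseteq> \<Union>\<D>" "\<Union>\<D> \<in> lmeasurable" "?\<mu> (\<Union>\<D>) \<le> ?\<mu> K + e"
    by metis
  have Dm: "D \<in> lmeasurable" if "D \<in> \<D>" for D
    using box[OF that] by auto
  \<comment> \<open>An intersection of two boxes is convex, so without interior it is negligible.
    Hence measures add up over finite subfamilies.\<close>
  have neg: "pairwise (\<lambda>A B. negligible (A \<inter> B)) \<D>"
    unfolding pairwise_def
  proof (intro ballI impI)
    fix A B assume AB: "A \<in> \<D>" "B \<in> \<D>" "A \<noteq> B"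
    then have "convex (A \<inter> B)"
      using box by (metis convex_Int convex_box(1))
    then show "negligible (A \<inter> B)"
      using dis AB by (simp add: negligible_convex_interior pairwise_def)
  qed
  \<comment> \<open>It suffices to bound the finite subunions, and there \<open>sparse\<close> is
    summed over the boxes.\<close>
  have "?\<mu> (\<Union>((\<inter>) K ` \<D>)) \<le> \<theta> * (?\<mu> K + e)"
  proof (rule measure_Union_bound)
    show "countable ((\<inter>) K ` \<D>)"
      using cD by simp
    show "A \<in> lmeasurable" if "A \<in> (\<inter>) K ` \<D>" for A
      using that Km Dm by (auto intro!: fmeasurable.Int)
    fix \<E> assume "\<E> \<subseteq> (\<inter>) K ` \<D>" "finite \<E>"
    then obtain \<F> where \<F>: "\<F> \<subseteq> \<D>" "finite \<F>" "\<E> = (\<inter>) K ` \<F>"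
      by (meson finite_subset_image)
    have "?\<mu> (\<Union>\<E>) \<le> (\<Sum>D\<in>\<F>. ?\<mu> (K \<inter> D))"
      unfolding \<F>(3) using \<F> Km Dm by (intro measure_UNION_le) (auto intro!: fmeasurableD fmeasurable.Int)
    also have "\<dots> \<le> (\<Sum>D\<in>\<F>. \<theta> * ?\<mu> D)"
    proof (rule sum_mono)
      fix D assume "D \<in> \<F>"
      then obtain c d where "D = cbox c d"
        using box \<F> by blast
      then show "?\<mu> (K \<inter> D) \<le> \<theta> * ?\<mu> D"
        using sparse[of c d] by (simp only: cbox_interval Int_commute)
    qed
    also have "\<dots> = \<theta> * ?\<mu> (\<Union>\<F>)"
      using measure_negligible_finite_Union[OF \<F>(2), unfolded pairwise_def] \<F> Dm neg
      by (simp add: sum_distrib_left pairwise_def subset_eq)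
    also have "\<dots> \<le> \<theta> * ?\<mu> (\<Union>\<D>)"
      using \<F> Dm cover(2) \<theta>
      by (intro mult_left_mono measure_mono_fmeasurable sets.finite_Union) auto
    also have "\<dots> \<le> \<theta> * (?\<mu> K + e)"
      using cover(3) \<theta> by (intro mult_left_mono) auto
    finally show "?\<mu> (\<Union>\<E>) \<le> \<theta> * (?\<mu> K + e)" .
  qed
  moreover have "\<Union>((\<inter>) K ` \<D>) = K"
    using cover(1) by auto
  ultimately have "?\<mu> K \<le> \<theta> * ?\<mu> K + \<theta> * e"
    by (simp add: algebra_simps)
  also have "\<theta> * e \<le> e"
    using \<theta> \<open>e > 0\<close> by (simp add: mult_left_le_one_le)
  finally have "(1 - \<theta>) * ?\<mu> K \<le> e"
    by (simp add: algebra_simps)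
  then show False
    using \<theta> K(2) by (simp add: e_def)
qed

section \<open>Lifting curve fragments\<close>

text \<open>Fragments are kept as maps into the carrier with a pseudometric, not into the set of
  null classes, so that \<open>f\<close> can be applied to them and lifts can be sought directly in
  \<open>M\<close>.\<close>

definition Lipschitz_wrt :: "('a \<Rightarrow> 'a \<Rightarrow> real) \<Rightarrow> real \<Rightarrow> real set \<Rightarrow> (real \<Rightarrow> 'a) \<Rightarrow> bool" where
  "Lipschitz_wrt p c K \<phi> \<longleftrightarrow> (\<forall>s\<in>K. \<forall>t\<in>K. p (\<phi> s) (\<phi> t) \<le> c * dist s t)"

lemma pseudometric_onD:
  assumes "pseudometric_on X p"
  shows "x \<in> X \<Longrightarrow> p x x = 0" "x \<in> X \<Longrightarrow> y \<in> X \<Longrightarrow> 0 \<le> p x y"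
    "x \<in> X \<Longrightarrow> y \<in> X \<Longrightarrow> p x y = p y x"
    "x \<in> X \<Longrightarrow> y \<in> X \<Longrightarrow> z \<in> X \<Longrightarrow> p x z \<le> p x y + p y z"
  using assms by (simp_all add: pseudometric_on_def)

lemma null_class_eq:
  assumes "pseudometric_on X p" "x \<in> X" "y \<in> X" "p x y = 0"
  shows "null_class X p x = null_class X p y"
proof -
  have "mdist (quotient_metric X p) (null_class X p x) (null_class X p y) = 0"
    using assms by (simp add: mdist_quotient_metric)
  then show ?thesis
    using assms by (simp add: mspace_quotient_metric)
qed

text \<open>Stretching the domain by \<open>c\<close> turns the fragment into a 1-Lipschitz one in
  the quotient and multiplies the measure of its gaps by \<open>c\<close>. Since only classes matter
  there, the ends need to match only up to distance 0.\<close>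

lemma curve_flat_step_le_gap:
  assumes ps: "pseudometric_on X p" and K: "compact K" "K \<noteq> {}" "\<phi> \<in> K \<rightarrow> X"
    and lip: "Lipschitz_wrt p c K \<phi>" and c: "c > 0"
    and xy: "x \<in> X" "y \<in> X" "p x (\<phi> (Inf K)) = 0" "p (\<phi> (Sup K)) y = 0"
  shows "curve_flat_step X p x y \<le> c * measure lebesgue ({Inf K..Sup K} - K)"
proof -
  have bdd: "bdd_below K" "bdd_above K"
    using K by (simp_all add: compact_imp_bounded bounded_imp_bdd_below bounded_imp_bdd_above)
  have IS: "Inf K \<in> K" "Sup K \<in> K"
    using K bdd by (simp_all add: closed_contains_Inf closed_contains_Sup compact_imp_closed)
  have bd: "Inf K \<le> s" "s \<le> Sup K" if "s \<in> K" for s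
    using bdd that by (simp_all add: cInf_lower cSup_upper)
  let ?K = "(*) c ` K"
  have IS': "Inf ?K = c * Inf K" "Sup ?K = c * Sup K"
    using IS bd c by (auto intro!: cInf_eq_minimum cSup_eq_maximum)
  define \<psi> where "\<psi> s = null_class X p (\<phi> (s / c))" for s
  have \<psi>: "\<psi> (c * s) = null_class X p (\<phi> s)" for s
    using c by (simp add: \<psi>_def)
  have "one_Lipschitz_fragment (quotient_metric X p) ?K \<psi>"
    unfolding one_Lipschitz_fragment_def
  proof (intro conjI ballI)
    show "compact ?K"
      using K(1) by (rule compact_scaling[where 'a = real, simplified real_scaleR_def])
    show "?K \<noteq> {}"
      using K by simp
    show "\<psi> \<in> ?K \<rightarrow> mspace (quotient_metric X p)"
      using K by (auto simp: \<psi> mspace_quotient_metric[OF ps])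
    show "mdist (quotient_metric X p) (\<psi> s) (\<psi> t) \<le> dist s t" if st: "s \<in> ?K" "t \<in> ?K" for s t
    proof -
      obtain a b where ab: "a \<in> K" "b \<in> K" "s = c * a" "t = c * b"
        using st by blast
      have "dist s t = c * dist a b"
        using c by (simp add: ab dist_real_def flip: right_diff_distrib abs_mult)
          (simp add: abs_mult)
      moreover have "\<phi> a \<in> X" "\<phi> b \<in> X"
        using ab K by auto
      ultimately show ?thesis
        using lip ab by (simp add: \<psi> mdist_quotient_metric[OF ps] Lipschitz_wrt_def)
    qed
  qed
  moreover have "\<psi> (Inf ?K) = null_class X p x" "\<psi> (Sup ?K) = null_class X p y"
    unfolding IS' \<psi> using null_class_eq[OF ps xy(1) _ xy(3)] null_class_eq[OF ps _ xy(2) xy(4)] IS K(3)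
    by auto
  ultimately have "curve_flat_step X p x y \<le> measure lebesgue ({Inf ?K..Sup ?K} - ?K)"
    unfolding curve_flat_step_def by (rule curve_flat_dist_le)
  also have "{Inf ?K..Sup ?K} - ?K = (*) c ` ({Inf K..Sup K} - K)"
    unfolding IS' using c by (simp add: image_set_diff[of "(*) c"] inj_on_def image_mult_atLeastAtMost)
  also have "measure lebesgue \<dots> = c * measure lebesgue ({Inf K..Sup K} - K)"
    using measure_lebesgue_affine[of c 0 "{Inf K..Sup K} - K"] c by simp
  finally show ?thesis .
qed

text \<open>A nearly optimal fragment in the quotient is replaced by a choice of representatives.
  The representatives chosen at the ends may differ from \<open>x\<close> and \<open>y\<close>,
  hence the conditions of distance 0.\<close>

lemma curve_flat_step_approx:
  assumes ps: "pseudometric_on X p" and xy: "x \<in> X" "y \<in> X" and "e > 0"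
  obtains K \<phi> where "compact K" "K \<noteq> {}" "\<phi> \<in> K \<rightarrow> X" "Lipschitz_wrt p 1 K \<phi>"
    "p x (\<phi> (Inf K)) = 0" "p (\<phi> (Sup K)) y = 0"
    "measure lebesgue ({Inf K..Sup K} - K) < curve_flat_step X p x y + e"
proof -
  let ?Q = "quotient_metric X p" and ?c = "null_class X p"
  have "?c x \<in> mspace ?Q" "?c y \<in> mspace ?Q"
    using xy by (simp_all add: mspace_quotient_metric[OF ps])
  from curve_flat_dist_approx[OF this \<open>e > 0\<close>] obtain K \<psi> where
    K: "one_Lipschitz_fragment ?Q K \<psi>" and ends: "\<psi> (Inf K) = ?c x" "\<psi> (Sup K) = ?c y"
    and gap: "measure lebesgue ({Inf K..Sup K} - K) < curve_flat_step X p x y + e"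
    unfolding curve_flat_step_def by blast
  define \<phi> where "\<phi> s = (SOME u. u \<in> X \<and> ?c u = \<psi> s)" for s
  have \<phi>: "\<phi> s \<in> X \<and> ?c (\<phi> s) = \<psi> s" if "s \<in> K" for s
    unfolding \<phi>_def
  proof (rule someI_ex)
    have "\<psi> s \<in> ?c ` X"
      using K that mspace_quotient_metric[OF ps] by (auto simp: one_Lipschitz_fragment_def)
    then show "\<exists>u. u \<in> X \<and> ?c u = \<psi> s"
      by auto
  qed
  have dist: "p u v = mdist ?Q (?c u) (?c v)" if "u \<in> X" "v \<in> X" for u v
    using that mdist_quotient_metric[OF ps] by simp
  note sp = one_Lipschitz_fragment_space[OF K]
  show ?thesis
  proof (rule that)
    show "compact K" "K \<noteq> {}" "\<phi> \<in> K \<rightarrow> X"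
      using K \<phi> by (auto simp: one_Lipschitz_fragment_def)
    show "Lipschitz_wrt p 1 K \<phi>"
      unfolding Lipschitz_wrt_def
    proof (intro ballI)
      fix s t assume "s \<in> K" "t \<in> K"
      then show "p (\<phi> s) (\<phi> t) \<le> 1 * dist s t"
        using K \<phi> dist[of "\<phi> s" "\<phi> t"] by (simp add: one_Lipschitz_fragment_def)
    qed
    show "p x (\<phi> (Inf K)) = 0" "p (\<phi> (Sup K)) y = 0"
      using dist[of x "\<phi> (Inf K)"] dist[of "\<phi> (Sup K)" y] \<phi>[OF sp(1)] \<phi>[OF sp(2)] ends xy sp(5,6)
      by simp_all
  qed (rule gap)
qed

text \<open>A pseudometric dominated by the metric changes by at most the sum of the displacements
  of its two arguments, so it is continuous for the original topology. This keeps compactness of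
  \<open>M\<close> usable at every stage of the iteration.\<close>

lemma continuous_map_pseudometric:
  assumes ps: "pseudometric_on (mspace M) p"
    and le: "\<And>x y. x \<in> mspace M \<Longrightarrow> y \<in> mspace M \<Longrightarrow> p x y \<le> mdist M x y"
    and g: "continuous_map T (mtopology_of M) g" and h: "continuous_map T (mtopology_of M) h"
  shows "continuous_map T euclideanreal (\<lambda>z. p (g z) (h z))"
proof -
  note pd = pseudometric_onD[OF ps]
  have "\<bar>p x y - p x' y'\<bar> \<le> 2 * prod_dist (mdist M) (mdist M) (x, y) (x', y')"
    if "x \<in> mspace M" "y \<in> mspace M" "x' \<in> mspace M" "y' \<in> mspace M" for x y x' y'
  proof -
    have "\<bar>p x y - p x' y'\<bar> \<le> p x x' + p y y'"
      using pd(4)[of x x' y] pd(4)[of x' y' y] pd(4)[of x' x y'] pd(4)[of x y y'] pd(3)[of x' x]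
        pd(3)[of y' y] that by linarith
    also have "\<dots> \<le> mdist M x x' + mdist M y y'"
      using le that by (intro add_mono) auto
    also have "\<dots> \<le> 2 * prod_dist (mdist M) (mdist M) (x, y) (x', y')"
      by (smt (verit) Metric_space12.component_le_prod_metric Metric_space12_mspace_mdist)
    finally show ?thesis .
  qed
  then have "Lipschitz_continuous_map (prod_metric M M) euclidean_metric (\<lambda>(x, y). p x y)"
    by (fastforce simp: Lipschitz_continuous_map_def dist_real_def)
  then have "continuous_map (prod_topology (mtopology_of M) (mtopology_of M)) euclideanreal
      (\<lambda>(x, y). p x y)"
    using Lipschitz_continuous_imp_continuous_map mtopology_of_prod_metric mtopology_of_euclidean
    by metis
  from continuous_map_compose[OF _ this] have "continuous_map T euclideanreal ((\<lambda>(x, y). p x y) \<circ> k)"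
    if "continuous_map T (prod_topology (mtopology_of M) (mtopology_of M)) k" for k
    using that .
  moreover have "continuous_map T (prod_topology (mtopology_of M) (mtopology_of M)) (\<lambda>z. (g z, h z))"
    using g h by (simp add: continuous_map_paired)
  ultimately show ?thesis
    by (fastforce simp: o_def)
qed

text \<open>The inclusion of closed balls at the exact radius, radius 0 included: if
  \<open>y\<close> has \<open>q\<close>-distance 0 from \<open>f x\<close>, some preimage of
  \<open>y\<close> has \<open>p\<close>-distance at most 0 from \<open>x\<close>.\<close>

definition co_Lipschitz_wrt ::
    "'a metric \<Rightarrow> 'b metric \<Rightarrow> ('a \<Rightarrow> 'b) \<Rightarrow> real \<Rightarrow> ('a \<Rightarrow> 'a \<Rightarrow> real) \<Rightarrow> ('b \<Rightarrow> 'b \<Rightarrow> real) \<Rightarrow> bool"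
  where "co_Lipschitz_wrt M N f C p q \<longleftrightarrow>
    (\<forall>x\<in>mspace M. \<forall>y\<in>mspace N. \<exists>z\<in>mspace M. f z = y \<and> p x z \<le> C * q (f x) y)"

text \<open>The points are lifted from left to right, each one starting from the lift of its
  predecessor. Distances on the line add up, so the constant \<open>C * c\<close> does not
  deteriorate.\<close>

lemma finite_lift:
  assumes ps: "pseudometric_on (mspace M) p" and co: "co_Lipschitz_wrt M N f C p q" "C > 0"
    and \<phi>: "\<phi> \<in> K \<rightarrow> mspace N" "Lipschitz_wrt q c K \<phi>"
    and t0: "t0 \<in> K" and x: "x \<in> mspace M" "f x = \<phi> t0"
    and F: "finite F" "F \<subseteq> K \<inter> {t0<..}"
  shows "\<exists>g. g t0 = x \<and> g \<in> insert t0 F \<rightarrow> mspace M \<and> (\<forall>s\<in>insert t0 F. f (g s) = \<phi> s) \<and>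
    Lipschitz_wrt p (C * c) (insert t0 F) g"
  using F
proof (induction F rule: finite_linorder_max_induct)
  case empty
  show ?case
    using x pseudometric_onD(1)[OF ps x(1)]
    by (intro exI[of _ "\<lambda>_. x"]) (auto simp: Lipschitz_wrt_def)
next
  case (insert b A)
  let ?A = "insert t0 A"
  have "A \<subseteq> K \<inter> {t0<..}"
    using insert.prems by simp
  from insert.IH[OF this] obtain g where
    g: "g t0 = x" "g \<in> ?A \<rightarrow> mspace M" "\<And>s. s \<in> ?A \<Longrightarrow> f (g s) = \<phi> s"
    and lipg: "Lipschitz_wrt p (C * c) ?A g"
    by blast
  have lip: "p (g s) (g t) \<le> C * c * dist s t" if "s \<in> ?A" "t \<in> ?A" for s t
    using lipg that unfolding Lipschitz_wrt_def by blast
  define m where "m = Max ?A"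
  have fin: "finite ?A"
    using insert.hyps by simp
  have m: "m \<in> ?A"
    unfolding m_def using fin by (rule Max_in) simp
  have m_ge: "s \<le> m" if "s \<in> ?A" for s
    unfolding m_def using fin that by (rule Max_ge)
  have m_less: "m < b"
    using m insert.hyps(2) insert.prems by auto
  have bK: "b \<in> K" "m \<in> K"
    using insert.prems t0 m by auto
  then obtain z where z: "z \<in> mspace M" "f z = \<phi> b" "p (g m) z \<le> C * q (f (g m)) (\<phi> b)"
    using co(1) m g(2) \<phi>(1) unfolding co_Lipschitz_wrt_def by (metis PiE)
  have "q (\<phi> m) (\<phi> b) \<le> c * dist m b"
    using \<phi>(2) bK by (simp add: Lipschitz_wrt_def)
  then have "C * q (\<phi> m) (\<phi> b) \<le> C * (c * dist m b)"
    using co(2) by simp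
  then have pz: "p (g m) z \<le> C * c * dist m b"
    using z(3) g(3)[OF m] by simp
  \<comment> \<open>Every earlier \<open>s\<close> satisfies \<open>s \<le> m < b\<close>, so the
    triangle inequality through \<open>g m\<close> is exact on the line.\<close>
  have far: "p (g s) z \<le> C * c * dist s b" if "s \<in> ?A" for s
  proof -
    have "p (g s) z \<le> p (g s) (g m) + p (g m) z"
      using that m g(2) z(1) by (intro pseudometric_onD(4)[OF ps]) auto
    also have "\<dots> \<le> C * c * dist s m + C * c * dist m b"
      using lip[OF that m] pz by simp
    also have "\<dots> = C * c * dist s b"
      using m_ge[OF that] m_less by (simp add: dist_real_def algebra_simps)
    finally show ?thesis .
  qed
  have b: "b \<notin> ?A"
    using m_ge m_less by force
  define h where "h = g(b := z)"
  have h: "h b = z" "\<And>s. s \<in> ?A \<Longrightarrow> h s = g s"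
    using b by (auto simp: h_def)
  show ?case
  proof (intro exI conjI ballI)
    show "h t0 = x"
      using h g(1) by simp
    show "h \<in> insert t0 (insert b A) \<rightarrow> mspace M"
      using h g(2) z(1) by auto
    show "f (h s) = \<phi> s" if "s \<in> insert t0 (insert b A)" for s
      using that h g(3) z(2) by auto
    have "p (h s) (h t) \<le> C * c * dist s t" if "s \<in> insert b ?A" "t \<in> insert b ?A" for s t
    proof -
      have far': "p z (g s) \<le> C * c * dist b s" if "s \<in> ?A" for s
      proof -
        have "g s \<in> mspace M"
          using g(2) that by (rule funcset_mem)
        then have "p z (g s) = p (g s) z"
          using z(1) by (intro pseudometric_onD(3)[OF ps])
        then show ?thesis
          using far[OF that] by (simp add: dist_commute)
      qed
      show ?thesis
      proof (cases "s = b"; cases "t = b")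
        assume "s = b" "t = b"
        then show ?thesis
          using pseudometric_onD(1)[OF ps z(1)] h(1) by simp
      next
        assume "s = b" "t \<noteq> b"
        then show ?thesis
          using that far'[of t] h(1) h(2)[of t] by simp
      next
        assume "s \<noteq> b" "t = b"
        then show ?thesis
          using that far[of s] h(1) h(2)[of s] by simp
      next
        assume "s \<noteq> b" "t \<noteq> b"
        then show ?thesis
          using that lip[of s t] h(2)[of s] h(2)[of t] by simp
      qed
    qed
    then show "Lipschitz_wrt p (C * c) (insert t0 (insert b A)) h"
      by (simp add: Lipschitz_wrt_def insert_commute)
  qed
qed

text \<open>The lifts over the finite subsets of \<open>K\<close> are glued by the compactness of \<open>M\<^sup>K\<close>.\<close>

lemma curve_lift:
  assumes cpt: "compact_space (mtopology_of M)" and f: "continuous_map (mtopology_of M) (mtopology_of N) f"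
    and ps: "pseudometric_on (mspace M) p"
    and le: "\<And>x y. x \<in> mspace M \<Longrightarrow> y \<in> mspace M \<Longrightarrow> p x y \<le> mdist M x y"
    and co: "co_Lipschitz_wrt M N f C p q" "C > 0"
    and \<phi>: "\<phi> \<in> K \<rightarrow> mspace N" "Lipschitz_wrt q c K \<phi>"
    and t0: "t0 \<in> K" "\<And>t. t \<in> K \<Longrightarrow> t0 \<le> t" and x: "x \<in> mspace M" "f x = \<phi> t0"
  obtains g where "g t0 = x" "g \<in> K \<rightarrow> mspace M" "\<And>t. t \<in> K \<Longrightarrow> f (g t) = \<phi> t"
    "Lipschitz_wrt p (C * c) K g"
proof -
  let ?P = "product_topology (\<lambda>_. mtopology_of M) K"
  \<comment> \<open>Each set constrains only the coordinates \<open>t0\<close>, \<open>s\<close> and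
    \<open>t\<close>, hence is closed in the product; a point common to all of them is the desired
    lift.\<close>
  define B where "B = (\<lambda>(s, t). {g \<in> topspace ?P. g t0 = x \<and> f (g s) = \<phi> s \<and>
    p (g s) (g t) \<le> C * c * dist s t})"
  have sing: "closedin (mtopology_of A) {a}" if "a \<in> mspace A" for A :: "'c metric" and a
    using that by (simp add: closedin_Hausdorff_sing_eq mtopology_of_def
        Metric_space.Hausdorff_space_mtopology Metric_space.topspace_mtopology)
  have "compact_space ?P"
    using cpt by (simp add: compact_space_product_topology)
  moreover have "closedin ?P C'" if "C' \<in> B ` (K \<times> K)" for C'
  proof -
    from that obtain s t where st: "s \<in> K" "t \<in> K" "C' = B (s, t)"
      by auto
    have pr: "continuous_map ?P (mtopology_of M) (\<lambda>g. g r)" if "r \<in> K" for r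
      using that by (rule continuous_map_product_projection)
    have "closedin ?P {g \<in> topspace ?P. g t0 \<in> {x}}"
      using pr[OF t0(1)] sing[OF x(1)] by (rule closedin_continuous_map_preimage)
    moreover have "closedin ?P {g \<in> topspace ?P. f (g s) \<in> {\<phi> s}}"
    proof (rule closedin_continuous_map_preimage)
      show "continuous_map ?P (mtopology_of N) (\<lambda>g. f (g s))"
        using continuous_map_compose[OF pr[OF st(1)] f] by (simp add: o_def)
      show "closedin (mtopology_of N) {\<phi> s}"
        using st \<phi> by (intro sing) auto
    qed
    moreover have "closedin ?P {g \<in> topspace ?P. p (g s) (g t) \<in> {..C * c * dist s t}}"
      using continuous_map_pseudometric[OF ps le pr[OF st(1)] pr[OF st(2)]]
      by (rule closedin_continuous_map_preimage) simp_all
    ultimately have "closedin ?P ({g \<in> topspace ?P. g t0 \<in> {x}} \<inter> {g \<in> topspace ?P. f (g s) \<in> {\<phi> s}}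
        \<inter> {g \<in> topspace ?P. p (g s) (g t) \<in> {..C * c * dist s t}})"
      by (intro closedin_Int)
    also have "\<dots> = C'"
      by (auto simp: st(3) B_def)
    finally show ?thesis .
  qed
  moreover have "\<Inter>\<F> \<noteq> {}" if \<F>: "finite \<F>" "\<F> \<subseteq> B ` (K \<times> K)" for \<F>
  proof -
    obtain G where G: "G \<subseteq> K \<times> K" "finite G" "\<F> = B ` G"
      using \<F> by (meson finite_subset_image)
    define F where "F = fst ` G \<union> snd ` G - {t0}"
    have "finite F" "F \<subseteq> K \<inter> {t0<..}"
      using G t0 by (force simp: F_def order_less_le)+
    from finite_lift[OF ps co \<phi> t0(1) x this] obtain g where
      g: "g t0 = x" "g \<in> insert t0 F \<rightarrow> mspace M" "\<And>s. s \<in> insert t0 F \<Longrightarrow> f (g s) = \<phi> s"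
        "Lipschitz_wrt p (C * c) (insert t0 F) g"
      by blast
    \<comment> \<open>A point of the product needs a value at every element of \<open>K\<close>. The
      filler \<open>x\<close> is arbitrary, as the constraints in \<open>G\<close> see only
      \<open>insert t0 F\<close>.\<close>
    define h where "h = (\<lambda>s\<in>K. if s \<in> insert t0 F then g s else x)"
    have hg: "h s = g s" if "s \<in> insert t0 F" for s
      using that t0(1) G(1) by (auto simp: h_def F_def)
    have "h \<in> topspace ?P"
      using x(1) g(2) by (auto simp: h_def topspace_product_topology)
    then have "h \<in> B z" if "z \<in> G" for z
    proof -
      obtain s t where st: "z = (s, t)"
        by fastforce
      then have "s \<in> insert t0 F" "t \<in> insert t0 F"
        using that by (force simp: F_def)+
      moreover from this have "p (g s) (g t) \<le> C * c * dist s t"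
        using g(4) unfolding Lipschitz_wrt_def by blast
      ultimately show ?thesis
        using \<open>h \<in> topspace ?P\<close> g(1,3) hg st by (simp add: B_def)
    qed
    then have "h \<in> \<Inter>\<F>"
      unfolding G(3) by (rule INT_I)
    then show ?thesis
      by blast
  qed
  ultimately have "\<Inter>(B ` (K \<times> K)) \<noteq> {}"
    unfolding compact_space_fip by blast
  then obtain g where g: "\<And>s t. s \<in> K \<Longrightarrow> t \<in> K \<Longrightarrow> g \<in> B (s, t)"
    by auto
  show ?thesis
  proof (rule that)
    show "g t0 = x" "g \<in> K \<rightarrow> mspace M"
      using g[OF t0(1) t0(1)] by (auto simp: B_def)
    show "f (g t) = \<phi> t" if "t \<in> K" for t
      using g[OF that that] by (simp add: B_def)
    show "Lipschitz_wrt p (C * c) K g"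
      using g by (simp add: B_def Lipschitz_wrt_def)
  qed
qed

section \<open>Iterated curve-flat quotients\<close>

text \<open>A measurable domain may be shrunk to a compact one of positive measure, and classes
  replaced by representatives. In this form the fragment can be lifted.\<close>

lemma not_purely_1_unrectifiable_quotient_iff:
  assumes ps: "pseudometric_on X p"
  shows "\<not> purely_1_unrectifiable (quotient_metric X p) \<longleftrightarrow>
    (\<exists>K g a b. compact K \<and> measure lebesgue K > 0 \<and> g \<in> K \<rightarrow> X \<and> a > 0 \<and> b > 0 \<and>
      (\<forall>s\<in>K. \<forall>t\<in>K. a * dist s t \<le> p (g s) (g t)) \<and> Lipschitz_wrt p b K g)" (is "?L \<longleftrightarrow> ?R")
proof
  let ?Q = "quotient_metric X p" and ?c = "null_class X p"
  have dist: "mdist ?Q (?c u) (?c v) = p u v" if "u \<in> X" "v \<in> X" for u v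
    using that mdist_quotient_metric[OF ps] by simp
  {
    assume ?L
    then obtain S f where S: "S \<in> sets lebesgue" "emeasure lebesgue S > 0" "bi_Lipschitz_on S ?Q f"
      unfolding purely_1_unrectifiable_def by blast
    then obtain a b where f: "f \<in> S \<rightarrow> mspace ?Q" "a > 0"
      and ab: "\<forall>s\<in>S. \<forall>t\<in>S.
        a * dist s t \<le> mdist ?Q (f s) (f t) \<and> mdist ?Q (f s) (f t) \<le> b * dist s t"
      unfolding bi_Lipschitz_on_def by blast
    obtain K where K: "compact K" "K \<subseteq> S" "measure lebesgue K > 0"
      using compact_subset_positive_measure[OF S(1,2)] .
    define g where "g s = (SOME u. u \<in> X \<and> ?c u = f s)" for s
    have g: "g s \<in> X \<and> ?c (g s) = f s" if "s \<in> K" for s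
      unfolding g_def
    proof (rule someI_ex)
      have "f s \<in> ?c ` X"
        using f(1) K(2) that mspace_quotient_metric[OF ps] by blast
      then show "\<exists>u. u \<in> X \<and> ?c u = f s"
        by auto
    qed
    have gd: "p (g s) (g t) = mdist ?Q (f s) (f t)" if "s \<in> K" "t \<in> K" for s t
      using dist g[OF that(1)] g[OF that(2)] by metis
    \<comment> \<open>The upper constant in \<open>bi_Lipschitz_on\<close> may have any sign;
      \<open>max b 1\<close> makes it positive.\<close>
    have "a * dist s t \<le> p (g s) (g t)" "p (g s) (g t) \<le> max b 1 * dist s t"
      if "s \<in> K" "t \<in> K" for s t
    proof -
      have st: "s \<in> S" "t \<in> S"
        using K(2) that by auto
      have "b * dist s t \<le> max b 1 * dist s t"
        by (intro mult_right_mono) auto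
      then show "a * dist s t \<le> p (g s) (g t)" "p (g s) (g t) \<le> max b 1 * dist s t"
        using ab st gd[OF that] by fastforce+
    qed
    then show ?R
      using K(1,3) f(2) g unfolding Lipschitz_wrt_def
      by (intro exI[of _ K] exI[of _ g] exI[of _ a] exI[of _ "max b 1"] conjI) auto
  next
    assume ?R
    then obtain K g a b where K: "compact K" "measure lebesgue K > 0" and g: "g \<in> K \<rightarrow> X" "a > 0"
      and low: "\<forall>s\<in>K. \<forall>t\<in>K. a * dist s t \<le> p (g s) (g t)" and lip: "Lipschitz_wrt p b K g"
      by blast
    have Km: "K \<in> lmeasurable"
      using K(1) by (rule lmeasurable_compact)
    have "bi_Lipschitz_on K ?Q (\<lambda>s. ?c (g s))"
      unfolding bi_Lipschitz_on_def
    proof (intro conjI exI ballI)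
      show "(\<lambda>s. ?c (g s)) \<in> K \<rightarrow> mspace ?Q"
        using g(1) mspace_quotient_metric[OF ps] by auto
      show "a > 0"
        by (rule g(2))
      show "a * dist s t \<le> mdist ?Q (?c (g s)) (?c (g t))" "mdist ?Q (?c (g s)) (?c (g t)) \<le> b * dist s t"
        if "s \<in> K" "t \<in> K" for s t
      proof -
        have "g s \<in> X" "g t \<in> X"
          using g(1) that by auto
        then show "a * dist s t \<le> mdist ?Q (?c (g s)) (?c (g t))"
          "mdist ?Q (?c (g s)) (?c (g t)) \<le> b * dist s t"
          using low lip that dist by (simp_all add: Lipschitz_wrt_def)
      qed
    qed
    moreover have "K \<in> sets lebesgue" "emeasure lebesgue K > 0"
      using Km K(2) by (auto simp: fmeasurableD emeasure_eq_measure2)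
    ultimately show ?L
      unfolding purely_1_unrectifiable_def by blast
  }
qed

text \<open>A bi-Lipschitz fragment with constants \<open>a\<close>, \<open>b\<close> almost fills
  some interval, with gaps below the fraction \<open>a / b\<close>. Running along it makes the
  curve-flat distance of the end values smaller than the lower bound \<open>a * dist u v\<close>, so
  the step strictly decreases.\<close>

lemma purely_1_unrectifiable_if_stable:
  assumes ps: "pseudometric_on X p"
    and stable: "\<And>x y. x \<in> X \<Longrightarrow> y \<in> X \<Longrightarrow> p x y \<le> curve_flat_step X p x y"
  shows "purely_1_unrectifiable (quotient_metric X p)"
proof (rule ccontr)
  assume "\<not> ?thesis"
  then obtain K g a b where K: "compact K" "measure lebesgue K > 0" and g: "g \<in> K \<rightarrow> X"
    and ab: "a > 0" "b > 0" and low: "\<forall>s\<in>K. \<forall>t\<in>K. a * dist s t \<le> p (g s) (g t)"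
    and lip: "Lipschitz_wrt p b K g"
    unfolding not_purely_1_unrectifiable_quotient_iff[OF ps] by blast
  have "a / b > 0"
    using ab by simp
  then obtain u v where uv: "u \<in> K" "v \<in> K" "u < v"
    and gap: "measure lebesgue ({u..v} - K) < a / b * (v - u)"
    using compact_almost_full_interval[OF K] by blast
  let ?K = "K \<inter> {u..v}"
  have IS: "Inf ?K = u" "Sup ?K = v"
    using uv by (auto intro!: cInf_eq_minimum cSup_eq_maximum)
  have gX: "g u \<in> X" "g v \<in> X"
    using g uv by auto
  have "curve_flat_step X p (g u) (g v) \<le> b * measure lebesgue ({Inf ?K..Sup ?K} - ?K)"
  proof (rule curve_flat_step_le_gap[OF ps])
    show "compact ?K"
      using K(1) by (simp add: compact_Int)
    show "?K \<noteq> {}" "g \<in> ?K \<rightarrow> X" "Lipschitz_wrt p b ?K g"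
      using uv g lip by (auto simp: Lipschitz_wrt_def)
    show "p (g u) (g (Inf ?K)) = 0" "p (g (Sup ?K)) (g v) = 0"
      unfolding IS using gX pseudometric_onD(1)[OF ps] by auto
  qed (use ab gX in auto)
  also have "{Inf ?K..Sup ?K} - ?K = {u..v} - K"
    unfolding IS by auto
  also have "b * measure lebesgue ({u..v} - K) < b * (a / b * (v - u))"
    using gap ab by (intro mult_strict_left_mono)
  also have "\<dots> = a * dist u v"
    using ab uv by (simp add: dist_real_def)
  also have "\<dots> \<le> p (g u) (g v)"
    using low uv by blast
  finally show False
    using stable[OF gX] by simp
qed

text \<open>A bi-Lipschitz curve fragment in the target lifts to a Lipschitz one, and the lift is bi-Lipschitz
  because the map itself is Lipschitz.\<close>

lemma purely_1_unrectifiable_Lipschitz_quotient: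
  assumes cpt: "compact_space (mtopology_of M)" and f: "continuous_map (mtopology_of M) (mtopology_of N) f"
    and ne: "mspace M \<noteq> {}"
    and ps: "pseudometric_on (mspace M) p"
    and le: "\<And>x y. x \<in> mspace M \<Longrightarrow> y \<in> mspace M \<Longrightarrow> p x y \<le> mdist M x y"
    and psq: "pseudometric_on (mspace N) q"
    and co: "co_Lipschitz_wrt M N f C p q" "C > 0"
    and lip: "\<And>x y. x \<in> mspace M \<Longrightarrow> y \<in> mspace M \<Longrightarrow> q (f x) (f y) \<le> L * p x y" "L > 0"
    and pu: "purely_1_unrectifiable (quotient_metric (mspace M) p)"
  shows "purely_1_unrectifiable (quotient_metric (mspace N) q)"
proof (rule ccontr)
  assume "\<not> ?thesis"
  then obtain K \<phi> a b where K: "compact K" "measure lebesgue K > 0" and \<phi>: "\<phi> \<in> K \<rightarrow> mspace N"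
    and ab: "a > 0" "b > 0" and low: "\<forall>s\<in>K. \<forall>t\<in>K. a * dist s t \<le> q (\<phi> s) (\<phi> t)"
    and lip\<phi>: "Lipschitz_wrt q b K \<phi>"
    unfolding not_purely_1_unrectifiable_quotient_iff[OF psq] by blast
  have "K \<noteq> {}"
    using K(2) by auto
  with K(1) have t0: "Inf K \<in> K" "\<And>t. t \<in> K \<Longrightarrow> Inf K \<le> t"
    by (simp_all add: closed_contains_Inf cInf_lower compact_imp_closed compact_imp_bounded
        bounded_imp_bdd_below)
  \<comment> \<open>The co-Lipschitz condition yields preimages only relative to a base point; any
    point of the nonempty \<open>M\<close> will do.\<close>
  obtain x0 where "x0 \<in> mspace M"
    using ne by blast
  moreover have "\<phi> (Inf K) \<in> mspace N"
    using \<phi> t0 by blast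
  ultimately obtain x where x: "x \<in> mspace M" "f x = \<phi> (Inf K)"
    using co(1) unfolding co_Lipschitz_wrt_def by blast
  obtain g where g: "g \<in> K \<rightarrow> mspace M" "\<And>t. t \<in> K \<Longrightarrow> f (g t) = \<phi> t" "Lipschitz_wrt p (C * b) K g"
    using curve_lift[OF cpt f ps le co \<phi> lip\<phi> t0 x] by metis
  have "a / L * dist s t \<le> p (g s) (g t)" if st: "s \<in> K" "t \<in> K" for s t
  proof -
    have "g s \<in> mspace M" "g t \<in> mspace M"
      using g(1) st by auto
    then have "a * dist s t \<le> L * p (g s) (g t)"
      using lip(1)[of "g s" "g t"] low g(2) st by force
    then show ?thesis
      using lip(2) by (simp add: field_simps)
  qed
  moreover have "a / L > 0" "C * b > 0"
    using ab lip(2) co(2) by auto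
  ultimately have "\<not> purely_1_unrectifiable (quotient_metric (mspace M) p)"
    unfolding not_purely_1_unrectifiable_quotient_iff[OF ps] using K g(1,3) by blast
  then show False
    using pu by simp
qed

section \<open>Transfinite induction along the iterated distances\<close>

lemma wellorder_zero_succ_limit:
  fixes \<alpha> :: "'o::wellorder"
  obtains (zero) "\<And>\<beta>. \<alpha> \<le> \<beta>" | (succ) \<beta> where "is_pred \<beta> \<alpha>"
    | (limit) \<beta> where "\<beta> < \<alpha>" "\<And>\<gamma>. \<not> is_pred \<gamma> \<alpha>"
proof (cases "\<exists>\<beta>. is_pred \<beta> \<alpha>")
  case True
  then show thesis
    using succ by blast
next
  case no_pred: False
  show thesis
  proof (cases "\<exists>\<beta>. \<beta> < \<alpha>")
    case True
    then show thesis
      using limit no_pred by blast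
  next
    case False
    then show thesis
      using zero by (simp add: not_less)
  qed
qed

lemma curve_flat_iter_le_mdist:
  fixes \<alpha> :: "'o::wellorder"
  assumes "x \<in> mspace M" "y \<in> mspace M"
  shows "curve_flat_iter M \<alpha> x y \<le> mdist M x y"
proof -
  define z where "z = (LEAST \<beta> :: 'o. True)"
  have z: "z \<le> \<beta>" for \<beta>
    unfolding z_def by (rule Least_le) simp
  then have "curve_flat_iter M z = mdist M"
    by (rule curve_flat_iter_zero)
  moreover have "curve_flat_iter M \<alpha> x y \<le> curve_flat_iter M z x y"
    using pseudometric_curve_flat_iter_antimono[of M \<alpha>] assms z[of \<alpha>]
    by (cases "z = \<alpha>") auto
  ultimately show ?thesis
    by simp
qed

lemma curve_flat_iter_limit_approx:
  fixes \<alpha> :: "'o::wellorder"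
  assumes "\<beta> < \<alpha>" "\<And>\<gamma>. \<not> is_pred \<gamma> \<alpha>" "e > 0"
  obtains \<gamma> where "\<gamma> < \<alpha>" "curve_flat_iter M \<gamma> x y < curve_flat_iter M \<alpha> x y + e"
proof -
  have "(INF \<gamma>\<in>{..<\<alpha>}. curve_flat_iter M \<gamma> x y) < curve_flat_iter M \<alpha> x y + e"
    using assms(3) by (subst curve_flat_iter_limit[OF assms(1,2), symmetric]) simp
  then have "\<exists>s\<in>(\<lambda>\<gamma>. curve_flat_iter M \<gamma> x y) ` {..<\<alpha>}. s < curve_flat_iter M \<alpha> x y + e"
    using assms(1) by (intro cInf_lessD) auto
  then show ?thesis
    using that by auto
qed

text \<open>At a successor, \<open>f\<close> maps a nearly optimal fragment to an
  \<open>L\<close>-Lipschitz one, whose gaps count \<open>L\<close> times. At a limit, an earlier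
  stage is nearly optimal.\<close>

lemma curve_flat_iter_Lipschitz:
  fixes \<alpha> :: "'o::wellorder"
  assumes f: "f \<in> mspace M \<rightarrow> mspace N" and L: "L > 0"
    and lip: "\<And>x y. x \<in> mspace M \<Longrightarrow> y \<in> mspace M \<Longrightarrow> mdist N (f x) (f y) \<le> L * mdist M x y"
  shows "x \<in> mspace M \<Longrightarrow> y \<in> mspace M \<Longrightarrow>
    curve_flat_iter N \<alpha> (f x) (f y) \<le> L * curve_flat_iter M \<alpha> x y"
proof (induction \<alpha> arbitrary: x y rule: less_induct)
  case (less \<alpha>)
  note xy = less.prems
  have fxy: "f x \<in> mspace N" "f y \<in> mspace N"
    using f xy by auto
  show ?case
  proof (cases \<alpha> rule: wellorder_zero_succ_limit)
    case zero
    then show ?thesis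
      using lip xy curve_flat_iter_zero[OF zero, of M] curve_flat_iter_zero[OF zero, of N] by simp
  next
    case (succ \<beta>)
    let ?p = "curve_flat_iter M \<beta>" and ?q = "curve_flat_iter N \<beta>"
    have \<beta>: "\<beta> < \<alpha>"
      using succ by (simp add: is_pred_def)
    have psp: "pseudometric_on (mspace M) ?p" and psq: "pseudometric_on (mspace N) ?q"
      by (rule pseudometric_curve_flat_iter)+
    have "curve_flat_step (mspace N) ?q (f x) (f y) \<le> L * curve_flat_step (mspace M) ?p x y"
    proof (rule field_le_epsilon)
      fix e :: real assume "e > 0"
      then have "e / L > 0"
        using L by simp
      obtain K \<phi> where K: "compact K" "K \<noteq> {}" "\<phi> \<in> K \<rightarrow> mspace M" "Lipschitz_wrt ?p 1 K \<phi>"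
        and ends: "?p x (\<phi> (Inf K)) = 0" "?p (\<phi> (Sup K)) y = 0"
        and gap: "measure lebesgue ({Inf K..Sup K} - K) < curve_flat_step (mspace M) ?p x y + e / L"
        by (rule curve_flat_step_approx[OF psp xy \<open>e / L > 0\<close>])
      have "Inf K \<in> K" "Sup K \<in> K"
        using K(1,2) by (simp_all add: closed_contains_Inf closed_contains_Sup compact_imp_closed
            compact_imp_bounded bounded_imp_bdd_below bounded_imp_bdd_above)
      then have IS: "\<phi> (Inf K) \<in> mspace M" "\<phi> (Sup K) \<in> mspace M"
        using K(3) by auto
      have "curve_flat_step (mspace N) ?q (f x) (f y) \<le> L * measure lebesgue ({Inf K..Sup K} - K)"
      proof (rule curve_flat_step_le_gap[OF psq K(1,2)])
        show "(\<lambda>s. f (\<phi> s)) \<in> K \<rightarrow> mspace N"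
          using f K(3) by auto
        show "Lipschitz_wrt ?q L K (\<lambda>s. f (\<phi> s))"
          unfolding Lipschitz_wrt_def
        proof (intro ballI)
          fix s t assume st: "s \<in> K" "t \<in> K"
          have "?q (f (\<phi> s)) (f (\<phi> t)) \<le> L * ?p (\<phi> s) (\<phi> t)"
            using K(3) st by (intro less.IH \<beta>) auto
          also have "\<dots> \<le> L * dist s t"
            using K(4) st L by (intro mult_left_mono) (auto simp: Lipschitz_wrt_def)
          finally show "?q (f (\<phi> s)) (f (\<phi> t)) \<le> L * dist s t" .
        qed
        \<comment> \<open>The induction hypothesis bounds this distance by \<open>L\<close> times
          0.\<close>
        show "?q (f x) (f (\<phi> (Inf K))) = 0"
          using less.IH[OF \<beta> xy(1) IS(1)] ends(1) fxy f IS pseudometric_onD(2)[OF psq, of "f x" "f (\<phi> (Inf K))"]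
          by fastforce
        show "?q (f (\<phi> (Sup K))) (f y) = 0"
          using less.IH[OF \<beta> IS(2) xy(2)] ends(2) fxy f IS pseudometric_onD(2)[OF psq, of "f (\<phi> (Sup K))" "f y"]
          by fastforce
      qed (use L fxy in auto)
      also have "\<dots> \<le> L * (curve_flat_step (mspace M) ?p x y + e / L)"
        using gap L by (intro mult_left_mono) auto
      also have "\<dots> = L * curve_flat_step (mspace M) ?p x y + e"
        using L by (simp add: field_simps)
      finally show "curve_flat_step (mspace N) ?q (f x) (f y) \<le> L * curve_flat_step (mspace M) ?p x y + e" .
    qed
    then show ?thesis
      using curve_flat_iter_succ[OF succ, of M] curve_flat_iter_succ[OF succ, of N] by simp
  next
    case (limit \<beta>)
    show ?thesis
    proof (rule field_le_epsilon)
      fix e :: real assume "e > 0"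
      then have "e / L > 0"
        using L by simp
      obtain \<gamma> where \<gamma>: "\<gamma> < \<alpha>" "curve_flat_iter M \<gamma> x y < curve_flat_iter M \<alpha> x y + e / L"
        by (rule curve_flat_iter_limit_approx[OF limit \<open>e / L > 0\<close>])
      have "curve_flat_iter N \<alpha> (f x) (f y) \<le> curve_flat_iter N \<gamma> (f x) (f y)"
        using pseudometric_curve_flat_iter_antimono[of N \<alpha>] \<gamma>(1) fxy by blast
      also have "\<dots> \<le> L * curve_flat_iter M \<gamma> x y"
        using less.IH \<gamma>(1) xy by blast
      also have "\<dots> \<le> L * (curve_flat_iter M \<alpha> x y + e / L)"
        using \<gamma>(2) L by (intro mult_left_mono) auto
      also have "\<dots> = L * curve_flat_iter M \<alpha> x y + e"
        using L by (simp add: field_simps)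
      finally show "curve_flat_iter N \<alpha> (f x) (f y) \<le> L * curve_flat_iter M \<alpha> x y + e" .
    qed
  qed
qed

text \<open>The fiber over \<open>y\<close> is closed in a compact space and \<open>p x\<close> is
  continuous on it, so the minimum exists. This removes the error term at successor and limit stages
  and so preserves the exact form of \<open>co_Lipschitz_wrt\<close>.\<close>

lemma fiber_distance_attained:
  assumes cpt: "compact_space (mtopology_of M)" and f: "continuous_map (mtopology_of M) (mtopology_of N) f"
    and ps: "pseudometric_on (mspace M) p"
    and le: "\<And>x y. x \<in> mspace M \<Longrightarrow> y \<in> mspace M \<Longrightarrow> p x y \<le> mdist M x y"
    and x: "x \<in> mspace M" and y: "y \<in> mspace N"
    and approx: "\<And>e. e > 0 \<Longrightarrow> \<exists>z\<in>mspace M. f z = y \<and> p x z \<le> c + e"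
  shows "\<exists>z\<in>mspace M. f z = y \<and> p x z \<le> c"
proof -
  let ?F = "{z \<in> topspace (mtopology_of M). f z \<in> {y}}"
  have "closedin (mtopology_of N) {y}"
    using y by (simp add: closedin_Hausdorff_sing_eq mtopology_of_def
        Metric_space.Hausdorff_space_mtopology Metric_space.topspace_mtopology)
  then have "compactin (mtopology_of M) ?F"
    using closedin_continuous_map_preimage[OF f] closedin_compact_space[OF cpt] by blast
  moreover have "continuous_map (mtopology_of M) euclideanreal (p x)"
    using continuous_map_pseudometric[OF ps le, of "mtopology_of M" "\<lambda>_. x" "\<lambda>z. z"] x by simp
  ultimately have "compact (p x ` ?F)"
    using image_compactin compactin_euclidean_iff by blast
  moreover have "p x ` ?F \<noteq> {}"
    using approx[of 1] by auto
  ultimately obtain z where z: "z \<in> ?F" "\<And>w. w \<in> ?F \<Longrightarrow> p x z \<le> p x w"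
    using compact_attains_inf[of "p x ` ?F"] by blast
  have "p x z \<le> c"
  proof (rule field_le_epsilon)
    fix e :: real assume "e > 0"
    then obtain w where "w \<in> mspace M" "f w = y" "p x w \<le> c + e"
      using approx by blast
    then show "p x z \<le> c + e"
      using z(2)[of w] by simp
  qed
  then show ?thesis
    using z(1) by auto
qed

text \<open>At a successor, a nearly optimal fragment from \<open>f x\<close> to \<open>y\<close> is
  lifted to one starting over \<open>x\<close>; its gaps are unchanged, and the Lipschitz constant
  \<open>C\<close> of the lift becomes the factor.\<close>

lemma curve_flat_iter_co_Lipschitz:
  fixes \<alpha> :: "'o::wellorder"
  assumes cpt: "compact_space (mtopology_of M)" and cont: "continuous_map (mtopology_of M) (mtopology_of N) f"
    and f: "f \<in> mspace M \<rightarrow> mspace N" and C: "C > 0"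
    and co: "co_Lipschitz_wrt M N f C (mdist M) (mdist N)"
  shows "co_Lipschitz_wrt M N f C (curve_flat_iter M \<alpha>) (curve_flat_iter N \<alpha>)"
proof (induction \<alpha> rule: less_induct)
  case (less \<alpha>)
  show ?case
    unfolding co_Lipschitz_wrt_def
  proof (intro ballI)
    fix x y assume x: "x \<in> mspace M" and y: "y \<in> mspace N"
    have fx: "f x \<in> mspace N"
      using f x by auto
    show "\<exists>z\<in>mspace M. f z = y \<and> curve_flat_iter M \<alpha> x z \<le> C * curve_flat_iter N \<alpha> (f x) y"
    proof (cases \<alpha> rule: wellorder_zero_succ_limit)
      case zero
      then show ?thesis
        using co x y curve_flat_iter_zero[OF zero, of M] curve_flat_iter_zero[OF zero, of N]
        by (simp add: co_Lipschitz_wrt_def)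
    next
      case (succ \<beta>)
      let ?p = "curve_flat_iter M \<beta>" and ?q = "curve_flat_iter N \<beta>"
      have \<beta>: "\<beta> < \<alpha>"
        using succ by (simp add: is_pred_def)
      have psp: "pseudometric_on (mspace M) ?p" and psq: "pseudometric_on (mspace N) ?q"
        by (rule pseudometric_curve_flat_iter)+
      note co\<beta> = less.IH[OF \<beta>]
      show ?thesis
      proof (rule fiber_distance_attained[OF cpt cont pseudometric_curve_flat_iter
            curve_flat_iter_le_mdist x y])
        fix e :: real assume "e > 0"
        then have "e / C > 0"
          using C by simp
        obtain K \<phi> where K: "compact K" "K \<noteq> {}" "\<phi> \<in> K \<rightarrow> mspace N" "Lipschitz_wrt ?q 1 K \<phi>"
          and ends: "?q (f x) (\<phi> (Inf K)) = 0" "?q (\<phi> (Sup K)) y = 0"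
          and gap: "measure lebesgue ({Inf K..Sup K} - K) < curve_flat_step (mspace N) ?q (f x) y + e / C"
          by (rule curve_flat_step_approx[OF psq fx y \<open>e / C > 0\<close>])
        have IS: "Inf K \<in> K" "Sup K \<in> K" "\<And>t. t \<in> K \<Longrightarrow> Inf K \<le> t"
          using K(1,2) by (simp_all add: closed_contains_Inf closed_contains_Sup compact_imp_closed
              compact_imp_bounded bounded_imp_bdd_below bounded_imp_bdd_above cInf_lower)
        \<comment> \<open>The fragment starts only at distance 0 from \<open>f x\<close>, so the
          lift starts at a preimage \<open>x0\<close> of its first point at distance 0 from
          \<open>x\<close>. The far end is corrected to a point \<open>z\<close> over
          \<open>y\<close> in the same way.\<close>
        have "\<phi> (Inf K) \<in> mspace N"
          using K(3) IS by auto
        then obtain x0 where x0: "x0 \<in> mspace M" "f x0 = \<phi> (Inf K)" "?p x x0 \<le> C * ?q (f x) (\<phi> (Inf K))"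
          using co\<beta> x unfolding co_Lipschitz_wrt_def by blast
        have px0: "?p x x0 = 0"
          using x0(3) ends(1) pseudometric_onD(2)[OF psp x x0(1)] by simp
        obtain g where g: "g (Inf K) = x0" "g \<in> K \<rightarrow> mspace M" "\<And>t. t \<in> K \<Longrightarrow> f (g t) = \<phi> t"
          "Lipschitz_wrt ?p (C * 1) K g"
          using curve_lift[OF cpt cont psp curve_flat_iter_le_mdist co\<beta> C K(3,4) IS(1,3) x0(1,2)]
          by metis
        have gS: "g (Sup K) \<in> mspace M"
          using g(2) IS by auto
        then obtain z where z: "z \<in> mspace M" "f z = y" "?p (g (Sup K)) z \<le> C * ?q (f (g (Sup K))) y"
          using co\<beta> y unfolding co_Lipschitz_wrt_def by blast
        have pz: "?p (g (Sup K)) z = 0"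
          using z(3) ends(2) g(3)[OF IS(2)] pseudometric_onD(2)[OF psp gS z(1)] by simp
        have "curve_flat_step (mspace M) ?p x z \<le> (C * 1) * measure lebesgue ({Inf K..Sup K} - K)"
          by (rule curve_flat_step_le_gap[OF psp K(1,2) g(2,4)]) (use C x z px0 pz g(1) in auto)
        also have "\<dots> \<le> C * (curve_flat_step (mspace N) ?q (f x) y + e / C)"
          using gap C by simp
        also have "\<dots> = C * curve_flat_step (mspace N) ?q (f x) y + e"
          using C by (simp add: field_simps)
        finally show "\<exists>z\<in>mspace M. f z = y \<and>
            curve_flat_iter M \<alpha> x z \<le> C * curve_flat_iter N \<alpha> (f x) y + e"
          using z curve_flat_iter_succ[OF succ, of M] curve_flat_iter_succ[OF succ, of N] by auto
      qed
    next
      case (limit \<beta>)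
      show ?thesis
      proof (rule fiber_distance_attained[OF cpt cont pseudometric_curve_flat_iter
            curve_flat_iter_le_mdist x y])
        fix e :: real assume "e > 0"
        then have "e / C > 0"
          using C by simp
        obtain \<gamma> where \<gamma>: "\<gamma> < \<alpha>" "curve_flat_iter N \<gamma> (f x) y < curve_flat_iter N \<alpha> (f x) y + e / C"
          by (rule curve_flat_iter_limit_approx[OF limit \<open>e / C > 0\<close>])
        obtain z where z: "z \<in> mspace M" "f z = y"
          "curve_flat_iter M \<gamma> x z \<le> C * curve_flat_iter N \<gamma> (f x) y"
          using less.IH[OF \<gamma>(1)] x y unfolding co_Lipschitz_wrt_def by blast
        have "curve_flat_iter M \<alpha> x z \<le> curve_flat_iter M \<gamma> x z"
          using pseudometric_curve_flat_iter_antimono[of M \<alpha>] \<gamma>(1) x z(1) by blast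
        also have "\<dots> \<le> C * curve_flat_iter N \<gamma> (f x) y"
          by (rule z(3))
        also have "\<dots> \<le> C * (curve_flat_iter N \<alpha> (f x) y + e / C)"
          using \<gamma>(2) C by (intro mult_left_mono) auto
        also have "\<dots> = C * curve_flat_iter N \<alpha> (f x) y + e"
          using C by (simp add: field_simps)
        finally show "\<exists>z\<in>mspace M. f z = y \<and>
            curve_flat_iter M \<alpha> x z \<le> C * curve_flat_iter N \<alpha> (f x) y + e"
          using z by blast
      qed
    qed
  qed
qed

section \<open>Stabilization of the iterated distances\<close>

lemma compact_space_countable_dense:
  assumes "compact_space (mtopology_of M)"
  obtains D where "countable D" "D \<subseteq> mspace M"
    "\<And>x e. x \<in> mspace M \<Longrightarrow> e > 0 \<Longrightarrow> \<exists>u\<in>D. mdist M u x < e"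
proof -
  interpret MM: Metric_space "mspace M" "mdist M"
    by simp
  have "MM.mtotally_bounded (mspace M)"
    using assms MM.compact_space_eq_mcomplete_mtotally_bounded by (simp add: mtopology_of_def)
  then have "\<exists>F. finite F \<and> F \<subseteq> mspace M \<and> mspace M \<subseteq> (\<Union>x\<in>F. MM.mball x (inverse (Suc n)))" for n
    unfolding MM.mtotally_bounded_def by simp
  then obtain F where F: "\<And>n. finite (F n)" "\<And>n. F n \<subseteq> mspace M"
    "\<And>n. mspace M \<subseteq> (\<Union>x\<in>F n. MM.mball x (inverse (Suc n)))"
    by metis
  show ?thesis
  proof (rule that)
    show "countable (\<Union>n. F n)" "(\<Union>n. F n) \<subseteq> mspace M"
      using F(1,2) by (auto intro: countable_finite)
    fix x and e :: real assume x: "x \<in> mspace M" and "e > 0"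
    then obtain n where n: "inverse (Suc n) < e"
      using reals_Archimedean by blast
    obtain u where "u \<in> F n" "x \<in> MM.mball u (inverse (Suc n))"
      using F(3) x by blast
    then show "\<exists>u\<in>(\<Union>n. F n). mdist M u x < e"
      using n by (intro bexI[of _ u]) auto
  qed
qed

text \<open>As long as the iterated distances strictly decrease, each step crosses a rational at some pair of
  points of a countable dense set, and no two steps can cross the same rational at the same pair.\<close>

lemma curve_flat_index_exists:
  assumes cpt: "compact_space (mtopology_of M)"
  shows "\<exists>\<alpha> :: 'u::infinite ordinal. purely_1_unrectifiable (curve_flat_quotient M \<alpha>)"
proof (rule ccontr)
  assume no: "\<not> ?thesis"
  let ?d = "curve_flat_iter M :: 'u ordinal \<Rightarrow> _"
  obtain D where D: "countable D" "D \<subseteq> mspace M"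
    and dense: "\<And>x e. x \<in> mspace M \<Longrightarrow> e > 0 \<Longrightarrow> \<exists>u\<in>D. mdist M u x < e"
    using compact_space_countable_dense[OF cpt] by blast
  \<comment> \<open>A triple records the pair and the rational crossed between \<alpha> and its
    successor; \<open>None\<close> is reserved for an ordinal without successor.\<close>
  define W where "W \<alpha> w \<longleftrightarrow> (case w of None \<Rightarrow> \<not> (\<exists>\<sigma>. is_pred \<alpha> \<sigma>)
    | Some (u, v, r) \<Rightarrow> u \<in> D \<and> v \<in> D \<and> r \<in> \<rat> \<and> (\<exists>\<sigma>. is_pred \<alpha> \<sigma> \<and> ?d \<sigma> u v < r \<and> r < ?d \<alpha> u v))"
    for \<alpha> w
  have "\<exists>w. W \<alpha> w" for \<alpha>
  proof (cases "\<exists>\<sigma>. is_pred \<alpha> \<sigma>")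
    case False
    then show ?thesis
      by (intro exI[of _ None]) (simp add: W_def)
  next
    case True
    then obtain \<sigma> where \<sigma>: "is_pred \<alpha> \<sigma>"
      by blast
    \<comment> \<open>Without a strict decrease the \<alpha>-th distance is stable, and its quotient
      would be purely 1-unrectifiable.\<close>
    have "\<exists>x\<in>mspace M. \<exists>y\<in>mspace M. ?d \<sigma> x y < ?d \<alpha> x y"
    proof (rule ccontr)
      assume "\<not> ?thesis"
      then have "purely_1_unrectifiable (curve_flat_quotient M \<alpha>)"
        unfolding curve_flat_quotient_def
        using curve_flat_iter_succ[OF \<sigma>, of M]
        by (intro purely_1_unrectifiable_if_stable pseudometric_curve_flat_iter) (force simp: not_less)
      then show False
        using no by blast
    qed
    then obtain x y where xy: "x \<in> mspace M" "y \<in> mspace M" "?d \<sigma> x y < ?d \<alpha> x y"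
      by blast
    \<comment> \<open>Passing to dense points changes each of the two distances by less than
      \<open>2 * \<delta>\<close>, so a drop of \<open>5 * \<delta>\<close> survives.\<close>
    define \<delta> where "\<delta> = (?d \<alpha> x y - ?d \<sigma> x y) / 5"
    have \<delta>: "5 * \<delta> = ?d \<alpha> x y - ?d \<sigma> x y"
      by (simp add: \<delta>_def)
    then have "\<delta> > 0"
      using xy(3) by linarith
    obtain u v where u: "u \<in> D" "mdist M u x < \<delta>" and v: "v \<in> D" "mdist M v y < \<delta>"
      using dense[OF xy(1) \<open>\<delta> > 0\<close>] dense[OF xy(2) \<open>\<delta> > 0\<close>] by blast
    have uv: "u \<in> mspace M" "v \<in> mspace M"
      using u v D(2) by auto
    have near: "\<bar>?d \<gamma> u v - ?d \<gamma> x y\<bar> < 2 * \<delta>" for \<gamma>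
    proof -
      note pd = pseudometric_onD[OF pseudometric_curve_flat_iter[of M \<gamma>]]
      have "?d \<gamma> u x < \<delta>" "?d \<gamma> v y < \<delta>"
        using curve_flat_iter_le_mdist[of u M x \<gamma>] curve_flat_iter_le_mdist[of v M y \<gamma>] uv xy u v
        by auto
      then show ?thesis
        using pd(4)[of u x v] pd(4)[of x y v] pd(4)[of x u y] pd(4)[of u v y] pd(3)[of u x] pd(3)[of v y]
          uv xy by linarith
    qed
    have "?d \<sigma> u v < ?d \<alpha> u v"
      using near[of \<sigma>] near[of \<alpha>] \<delta> \<open>\<delta> > 0\<close> by linarith
    then obtain r where "r \<in> \<rat>" "?d \<sigma> u v < r" "r < ?d \<alpha> u v"
      using Rats_dense_in_real by blast
    then show ?thesis
      using u v \<sigma> by (intro exI[of _ "Some (u, v, r)"]) (auto simp: W_def)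
  qed
  then obtain h where h: "\<And>\<alpha>. W \<alpha> (h \<alpha>)"
    by metis
  have "inj h"
  proof (rule linorder_injI)
    fix \<alpha> \<beta> :: "'u ordinal" assume "\<alpha> < \<beta>"
    then obtain \<sigma> where \<sigma>: "is_pred \<alpha> \<sigma>"
      by (rule exists_is_pred)
    show "h \<alpha> \<noteq> h \<beta>"
    proof
      assume eq: "h \<alpha> = h \<beta>"
      \<comment> \<open>\<open>None\<close> is excluded because \<alpha>, lying below \<beta>, has a
        successor.\<close>
      obtain u v r where hs: "h \<alpha> = Some (u, v, r)"
        using h[of \<alpha>] \<sigma> by (cases "h \<alpha>") (auto simp: W_def)
      from h[of \<alpha>] hs obtain \<sigma>' where \<sigma>': "is_pred \<alpha> \<sigma>'" "?d \<sigma>' u v < r" and uv: "u \<in> D" "v \<in> D"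
        by (auto simp: W_def)
      have "r < ?d \<beta> u v"
        using h[of \<beta>] hs eq by (auto simp: W_def)
      \<comment> \<open>The distance at \<open>(u, v)\<close> is below \<open>r\<close> from the
        successor of \<alpha> onwards, hence at \<beta>, which contradicts a second crossing
        there.\<close>
      have "\<sigma>' \<le> \<beta>"
        using \<sigma>'(1) \<open>\<alpha> < \<beta>\<close> by (meson is_pred_def leD not_le)
      moreover have "u \<in> mspace M" "v \<in> mspace M"
        using uv D(2) by auto
      ultimately have "?d \<beta> u v \<le> ?d \<sigma>' u v"
        using pseudometric_curve_flat_iter_antimono[of M \<beta>] by (cases "\<sigma>' = \<beta>") auto
      then show False
        using \<sigma>'(2) \<open>r < ?d \<beta> u v\<close> by simp
    qed
  qed
  moreover have "range h \<subseteq> insert None (Some ` (D \<times> D \<times> \<rat>))"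
  proof (rule image_subsetI)
    show "h \<alpha> \<in> insert None (Some ` (D \<times> D \<times> \<rat>))" for \<alpha>
      using h[of \<alpha>] by (auto simp: W_def split: option.splits)
  qed
  moreover have "countable (insert None (Some ` (D \<times> D \<times> \<rat>)) :: ('a \<times> 'a \<times> real) option set)"
    using D(1) by (intro countable_insert countable_image countable_SIGMA countable_rat)
  ultimately have "countable (UNIV :: 'u ordinal set)"
    using countable_image_inj_on countable_subset by blast
  then show False
    using uncountable_ordinal by blast
qed

text \<open>Nonemptiness excludes the vacuous case: an empty \<open>M\<close> has every
  \<open>N\<close> as a Lipschitz quotient, while its own index is the least ordinal.\<close>

theorem theorem4:
  fixes M :: "'a metric" and N :: "'b metric"
  assumes "compact_space (mtopology_of M)" and "compact_space (mtopology_of N)"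
    and "mspace M \<noteq> {}"
    and "Lipschitz_quotient_of N M"
  shows "(curve_flat_index N :: 'u::infinite ordinal) \<le> curve_flat_index M"
proof -
  obtain f where Lf: "Lipschitz_continuous_map M N f" and cof: "co_Lip M N f < \<infinity>"
    using assms(4)
    by (auto simp: Lipschitz_quotient_of_def Lipschitz_quotient_map_def co_Lipschitz_map_def)
  have f: "f \<in> mspace M \<rightarrow> mspace N"
    using Lf by (rule Lipschitz_continuous_map_image)
  have cont: "continuous_map (mtopology_of M) (mtopology_of N) f"
    using Lf by (rule Lipschitz_continuous_imp_continuous_map)
  obtain L where L: "L > 0"
    "\<And>x y. x \<in> mspace M \<Longrightarrow> y \<in> mspace M \<Longrightarrow> mdist N (f x) (f y) \<le> L * mdist M x y"
    using Lf unfolding Lipschitz_continuous_map_pos by blast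
  obtain C where C: "C > 0"
    and ball: "\<And>x r. x \<in> mspace M \<Longrightarrow> r > 0 \<Longrightarrow> mcball_of N (f x) r \<subseteq> f ` mcball_of M x (C * r)"
    using cof unfolding co_Lip_def Inf_less_iff by blast
  have "\<exists>z\<in>mspace M. f z = y \<and> mdist M x z \<le> C * mdist N (f x) y"
    if xy: "x \<in> mspace M" "y \<in> mspace N" for x y
  \<comment> \<open>Ball inclusions are available only for positive radii, so distance 0 is settled
    separately by \<open>x\<close> itself.\<close>
  proof (cases "y = f x")
    case True
    have diag: "mdist M x x = 0" "mdist N (f x) (f x) = 0"
      using xy True by simp_all
    show ?thesis
      using xy True by (intro bexI[of _ x]) (simp_all add: diag)
  next
    case False
    have fx: "f x \<in> mspace N"
      using f xy by auto
    then have "mdist N (f x) y > 0"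
      using False xy mdist_zero[of "f x" N y] by (simp add: order_less_le)
    moreover have "y \<in> mcball_of N (f x) (mdist N (f x) y)"
      using fx xy by simp
    ultimately have "y \<in> f ` mcball_of M x (C * mdist N (f x) y)"
      using ball xy by blast
    then show ?thesis
      by auto
  qed
  then have co: "co_Lipschitz_wrt M N f C (mdist M) (mdist N)"
    by (simp add: co_Lipschitz_wrt_def)
  let ?\<alpha> = "curve_flat_index M :: 'u ordinal"
  \<comment> \<open>\<open>LEAST\<close> is meaningful here only because stabilization provides some
    suitable ordinal. Its property then passes to \<open>N\<close> at the same ordinal.\<close>
  have "purely_1_unrectifiable (curve_flat_quotient M ?\<alpha>)"
    unfolding curve_flat_index_def by (rule LeastI_ex) (rule curve_flat_index_exists[OF assms(1)])
  then have "purely_1_unrectifiable (curve_flat_quotient N ?\<alpha>)"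
    unfolding curve_flat_quotient_def
    by (rule purely_1_unrectifiable_Lipschitz_quotient[OF assms(1) cont assms(3)
          pseudometric_curve_flat_iter curve_flat_iter_le_mdist pseudometric_curve_flat_iter
          curve_flat_iter_co_Lipschitz[OF assms(1) cont f C co] C
          curve_flat_iter_Lipschitz[OF f L] L(1), rotated -1])
  then show ?thesis
    unfolding curve_flat_index_def[of N] by (rule Least_le)
qed

end
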